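(* Let $\mu$ be a composition of $n$, $\tau\in\mathcal{I}_\mu$, and let $\mathbf{a}=(a_1,\dots,a_p)$ be a word such that $(\mathbf{a},m)$ is nearly $\mu$--reduced for $\tau$. Then there exists a unique $k\neq m$ such that $(\mathbf{a},k)$ is nearly $\mu$--reduced for $\tau$.
   Context: Permutations are in one-line notation; $\mathrm{std}$ is standardization. $\ell$ is Coxeter length, $s_i=(i,i{+}1)$, $e$ the identity. The 0--Hecke product is $w\circ s_i=ws_i$ if $\ell(ws_i)>\ell(w)$, else $w$ (similarly on the left). For a composition $\mu=(\mu_1,\dots,\mu_k)$ of $n$, $\pi\in S_n$ and $m_r=\mu_1+\dots+\mu_{r-1}$, the $r$th block is $B_r=\pi(m_r{+}1)\cdots\pi(m_r{+}\mu_r)$; $\pi$ is a $\mu$--involution ($\pi\in\mathcal{I}_\mu$) if each $\mathrm{std}(B_r)$ is an involution. For $\pi\in\mathcal{I}_\mu$, $i\in[n-1]$: if values $i,i{+}1$ are in different blocks, $\pi\circ_\mu s_i=s_i\circ\pi$; if in the same block $B$, replace $B$ by the word on the same values with standardization $s_r\circ\mathrm{std}(B)\circ s_r$, where $i$ is the $r$th smallest value of $B$. This extends to a right action of the 0--Hecke monoid. A word $\mathbf{a}=(a_1,\dots,a_p)$ is a $\mu$--word for $e\circ_\mu s_{a_1}\circ_\mu\cdots\circ_\mu s_{a_p}$; it is $\mu$--reduced if no shorter $\mu$--word gives the same element. $\mathcal{R}_\mu(\pi)$ is the set of $\mu$--reduced $\mu$--words for $\pi$. $(\mathbf{a},i)$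 is nearly $\mu$--reduced for $\tau$ if $\mathbf{a}$ is not $\mu$--reduced and $(a_1,\dots,\widehat{a_i},\dots,a_p)\in\mathcal{R}_\mu(\tau)$. *)

theory Defs
  imports "HOL-Combinatorics.Permutations"
begin

text \<open>
  A permutation in \<open>S\<^sub>n\<close> is a function \<open>w :: nat \<Rightarrow> nat\<close> with \<open>w permutes {1..n}\<close>; its one-line
  notation is \<open>map w [1..<Suc n]\<close>, and products are compositions of functions, so that
  \<open>w \<circ> s\<^sub>i\<close> swaps the positions \<open>i, i+1\<close> and \<open>s\<^sub>i \<circ> w\<close> swaps the values \<open>i, i+1\<close>.
  Positions, values and letters are numbered from 1, whereas the blocks of a composition are
  numbered from 0, as entries of a list.
\<close>

definition adj :: "nat \<Rightarrow> nat \<Rightarrow> nat" where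
  "adj i = transpose i (Suc i)"

definition cox_length :: "nat \<Rightarrow> (nat \<Rightarrow> nat) \<Rightarrow> nat" where
  "cox_length n w =
     (LEAST k. \<exists>ws \<in> lists {1..<n}. length ws = k \<and> w = foldr (\<circ>) (map adj ws) id)"

definition hecke_right :: "nat \<Rightarrow> (nat \<Rightarrow> nat) \<Rightarrow> nat \<Rightarrow> (nat \<Rightarrow> nat)" where
  "hecke_right n w i = (if cox_length n (w \<circ> adj i) > cox_length n w then w \<circ> adj i else w)"

definition hecke_left :: "nat \<Rightarrow> nat \<Rightarrow> (nat \<Rightarrow> nat) \<Rightarrow> (nat \<Rightarrow> nat)" where
  "hecke_left n i w = (if cox_length n (adj i \<circ> w) > cox_length n w then adj i \<circ> w else w)"

text \<open>Equal letters are numbered from left to right.\<close>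

definition std :: "nat list \<Rightarrow> nat \<Rightarrow> nat" where
  "std B j =
     (if j \<in> {1..length B}
      then card {i \<in> {1..length B}.
                   B ! (i - 1) < B ! (j - 1) \<or> B ! (i - 1) = B ! (j - 1) \<and> i \<le> j}
      else j)"

definition is_composition :: "nat \<Rightarrow> nat list \<Rightarrow> bool" where
  "is_composition n \<mu> \<longleftrightarrow> (\<forall>x \<in> set \<mu>. 0 < x) \<and> sum_list \<mu> = n"

definition block_start :: "nat list \<Rightarrow> nat \<Rightarrow> nat" where
  "block_start \<mu> r = sum_list (take r \<mu>)"

definition block :: "nat list \<Rightarrow> (nat \<Rightarrow> nat) \<Rightarrow> nat \<Rightarrow> nat list" where
  "block \<mu> \<pi> r = map (\<lambda>j. \<pi> (block_start \<mu> r + j)) [1..<Suc (\<mu> ! r)]"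

definition mu_involutions :: "nat list \<Rightarrow> (nat \<Rightarrow> nat) set" where
  "mu_involutions \<mu> =
     {\<pi>. \<pi> permutes {1..sum_list \<mu>} \<and>
         (\<forall>r < length \<mu>. std (block \<mu> \<pi> r) \<circ> std (block \<mu> \<pi> r) = id)}"

definition block_of :: "nat list \<Rightarrow> (nat \<Rightarrow> nat) \<Rightarrow> nat \<Rightarrow> nat" where
  "block_of \<mu> \<pi> v = (THE r. r < length \<mu> \<and> v \<in> set (block \<mu> \<pi> r))"

text \<open>The number \<open>r\<close> such that \<open>v\<close> is the \<open>r\<close>th smallest letter of \<open>B\<close>.\<close>

definition rank_in :: "nat list \<Rightarrow> nat \<Rightarrow> nat" where
  "rank_in B v = card {x \<in> set B. x \<le> v}"

text \<open>The word on the letters of \<open>B\<close> (assumed distinct) whose standardization is \<open>v\<close>.\<close>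

definition restd :: "nat list \<Rightarrow> (nat \<Rightarrow> nat) \<Rightarrow> nat list" where
  "restd B v = map (\<lambda>j. sort B ! (v j - 1)) [1..<Suc (length B)]"

definition replace_block :: "nat list \<Rightarrow> (nat \<Rightarrow> nat) \<Rightarrow> nat \<Rightarrow> nat list \<Rightarrow> (nat \<Rightarrow> nat)" where
  "replace_block \<mu> \<pi> b B' =
     (\<lambda>j. if j \<in> {block_start \<mu> b + 1..block_start \<mu> b + \<mu> ! b}
          then B' ! (j - block_start \<mu> b - 1) else \<pi> j)"

definition mu_act :: "nat list \<Rightarrow> (nat \<Rightarrow> nat) \<Rightarrow> nat \<Rightarrow> (nat \<Rightarrow> nat)" where
  "mu_act \<mu> \<pi> i =
     (if block_of \<mu> \<pi> i \<noteq> block_of \<mu> \<pi> (Suc i) then hecke_left (sum_list \<mu>) i \<pi>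
      else (let b = block_of \<mu> \<pi> i;
                B = block \<mu> \<pi> b;
                r = rank_in B i
            in replace_block \<mu> \<pi> b
                 (restd B (hecke_right (length B) (hecke_left (length B) r (std B)) r))))"

definition mu_eval :: "nat list \<Rightarrow> nat list \<Rightarrow> (nat \<Rightarrow> nat)" where
  "mu_eval \<mu> a = foldl (mu_act \<mu>) id a"

definition mu_words :: "nat list \<Rightarrow> (nat \<Rightarrow> nat) \<Rightarrow> nat list set" where
  "mu_words \<mu> \<pi> = {a \<in> lists {1..<sum_list \<mu>}. mu_eval \<mu> a = \<pi>}"

definition mu_reduced :: "nat list \<Rightarrow> nat list \<Rightarrow> bool" where
  "mu_reduced \<mu> a \<longleftrightarrow>
     a \<in> lists {1..<sum_list \<mu>} \<and> \<not> (\<exists>b \<in> mu_words \<mu> (mu_eval \<mu> a). length b < length a)"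

definition mu_reduced_words :: "nat list \<Rightarrow> (nat \<Rightarrow> nat) \<Rightarrow> nat list set" where
  "mu_reduced_words \<mu> \<pi> = {a \<in> mu_words \<mu> \<pi>. mu_reduced \<mu> a}"

definition delete_at :: "nat \<Rightarrow> 'a list \<Rightarrow> 'a list" where
  "delete_at i a = take (i - 1) a @ drop i a"

definition nearly_mu_reduced ::
    "nat list \<Rightarrow> nat list \<Rightarrow> nat \<Rightarrow> (nat \<Rightarrow> nat) \<Rightarrow> bool" where
  "nearly_mu_reduced \<mu> a i \<tau> \<longleftrightarrow>
     a \<in> lists {1..<sum_list \<mu>} \<and> i \<in> {1..length a} \<and>
     \<not> mu_reduced \<mu> a \<and> delete_at i a \<in> mu_reduced_words \<mu> \<tau>"

end

theory Submission
  imports Defs "HOL-Library.Sublist"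
begin

text \<open>
  Forget the positions and keep, for every value \<open>v\<close>, the index \<open>b v\<close> of its block and the value
  \<open>y v\<close> that the involution of that block pairs with \<open>v\<close>. In terms of \<open>(b, y)\<close> a generator acts
  by conjugation, except that it creates the pair \<open>{i, i+1}\<close> when \<open>y\<close> fixes both values. Each
  state is encoded by a family of partial permutation matrices, and comparing the rank matrices
  of these entrywise is an order that behaves like Bruhat order: the action is increasing and
  monotone, every descent comes from a state below it, and the lifting property holds.

  Such an order gives the subword property, so that a word is reduced iff each of its letters
  acts strictly, and the theorem follows by an exchange argument. If \<open>a\<close> is nearly reduced and
  \<open>j\<close> is the first position whose letter acts trivially, then deleting position \<open>j\<close> does not
  change the element. The element before \<open>j\<close> has a descent at the \<open>j\<close>th letter, and its
  predecessor arises from the prefix by deleting exactly one letter \<open>k < j\<close>. These \<open>j\<close> and \<open>k\<close>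
  are the only two positions that can be deleted.
\<close>

section \<open>The exchange argument in an ordered set with a 0-Hecke action\<close>

lemma subseq_delete_one:
  assumes "subseq v w" "length w = Suc (length v)"
  shows "\<exists>u1 c u2. w = u1 @ c # u2 \<and> v = u1 @ u2"
  using assms
proof (induction v w rule: list_emb.induct)
  case (list_emb_Cons v w c)
  then have "v = w" by (simp add: subseq_same_length)
  then show ?case by (intro exI[of _ "[]"]) auto
next
  case (list_emb_Cons2 x y v w)
  then obtain u1 c u2 where "w = u1 @ c # u2" "v = u1 @ u2" by auto
  then show ?case using list_emb_Cons2 by (intro exI[of _ "x # u1"]) auto
qed (auto simp: length_Suc_conv)

lemma delete_at_append: "delete_at (Suc (length u)) (u @ c # v) = u @ v"
  by (simp add: delete_at_def)

lemma delete_at_split: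
  assumes "k \<in> {1..length w}"
  obtains u c v where "w = u @ c # v" "k = Suc (length u)" "delete_at k w = u @ v"
proof
  show "w = take (k - 1) w @ w ! (k - 1) # drop k w"
    using assms id_take_nth_drop[of "k - 1" w] by (simp add: Suc_le_lessD)
  show "k = Suc (length (take (k - 1) w))" using assms by (auto simp: min_def)
qed (simp add: delete_at_def)

text \<open>These are the features of Bruhat order that the exchange argument uses.
  \<open>pred_ex\<close> says that a letter acting trivially on \<open>x\<close> is a genuine
  descent of \<open>x\<close>; \<open>lifting\<close> is the lifting property when \<open>s\<close>
  is an ascent of both elements.\<close>

locale hecke_poset =
  fixes S :: "'x set" and A :: "'s set" and act :: "'x \<Rightarrow> 's \<Rightarrow> 'x" and e :: 'x
    and le :: "'x \<Rightarrow> 'x \<Rightarrow> bool"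
  assumes e_in: "e \<in> S"
    and act_in: "\<lbrakk>x \<in> S; s \<in> A\<rbrakk> \<Longrightarrow> act x s \<in> S"
    and le_trans: "\<lbrakk>le x y; le y z\<rbrakk> \<Longrightarrow> le x z"
    and le_antisym: "\<lbrakk>x \<in> S; y \<in> S; le x y; le y x\<rbrakk> \<Longrightarrow> x = y"
    and le_bot: "x \<in> S \<Longrightarrow> le e x"
    and le_act: "\<lbrakk>x \<in> S; s \<in> A\<rbrakk> \<Longrightarrow> le x (act x s)"
    and act_mono: "\<lbrakk>x \<in> S; y \<in> S; s \<in> A; le x y\<rbrakk> \<Longrightarrow> le (act x s) (act y s)"
    and act_idem: "\<lbrakk>x \<in> S; s \<in> A\<rbrakk> \<Longrightarrow> act (act x s) s = act x s"
    and pred_ex: "\<lbrakk>x \<in> S; s \<in> A; act x s = x\<rbrakk> \<Longrightarrow> \<exists>y \<in> S. y \<noteq> x \<and> act y s = x"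
    and lifting: "\<lbrakk>x \<in> S; y \<in> S; s \<in> A; act x s \<noteq> x; act y s \<noteq> y; le x (act y s)\<rbrakk> \<Longrightarrow> le x y"
begin

abbreviation run :: "'x \<Rightarrow> 's list \<Rightarrow> 'x" where
  "run x w \<equiv> foldl act x w"

abbreviation reduced :: "'s list \<Rightarrow> bool" where
  "reduced w \<equiv> w \<in> lists A \<and> (\<forall>v \<in> lists A. run e v = run e w \<longrightarrow> length w \<le> length v)"

primrec strict :: "'x \<Rightarrow> 's list \<Rightarrow> bool" where
  "strict x [] \<longleftrightarrow> True"
| "strict x (s # w) \<longleftrightarrow> act x s \<noteq> x \<and> strict (act x s) w"

lemma strict_append [simp]: "strict x (v @ w) \<longleftrightarrow> strict x v \<and> strict (run x v) w"
  by (induction v arbitrary: x) auto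

lemma run_in: "\<lbrakk>x \<in> S; w \<in> lists A\<rbrakk> \<Longrightarrow> run x w \<in> S"
  by (induction w arbitrary: x) (auto simp: act_in)

lemma run_mono: "\<lbrakk>x \<in> S; y \<in> S; w \<in> lists A; le x y\<rbrakk> \<Longrightarrow> le (run x w) (run y w)"
  by (induction w arbitrary: x y) (auto simp: act_in act_mono)

text \<open>By \<open>le_act\<close>, \<open>x\<close> lies below \<open>act x s = act y s\<close>,
  so \<open>lifting\<close> puts \<open>x\<close> below \<open>y\<close>; the roles are
  symmetric.\<close>

lemma act_inj:
  assumes "x \<in> S" "y \<in> S" "s \<in> A" "act x s \<noteq> x" "act y s \<noteq> y" "act x s = act y s"
  shows "x = y"
  using assms lifting[of x y s] lifting[of y x s] le_act[of x s] le_act[of y s]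
  by (auto intro: le_antisym)

lemma strict_run_inj:
  "\<lbrakk>x \<in> S; y \<in> S; w \<in> lists A; strict x w; strict y w; run x w = run y w\<rbrakk> \<Longrightarrow> x = y"
proof (induction w arbitrary: x y)
  case (Cons s w)
  then have "act x s = act y s" by (auto simp: act_in)
  with Cons.prems show ?case by (auto intro: act_inj)
qed simp

text \<open>The subword property, by induction on the last letter \<open>t\<close>. If
  \<open>t\<close> moves \<open>y\<close>, lifting puts \<open>y\<close> below the element before
  \<open>t\<close>. If \<open>t\<close> fixes \<open>y\<close>, a predecessor of \<open>y\<close>
  lies below that element, and appending \<open>t\<close> to its subword gives a subword for
  \<open>y\<close>.\<close>

lemma subword_of_le:
  "\<lbrakk>w \<in> lists A; y \<in> S; le y (run e w)\<rbrakk>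
    \<Longrightarrow> \<exists>v \<in> lists A. run e v = y \<and> subseq v w"
proof (induction w arbitrary: y rule: rev_induct)
  case Nil
  then show ?case using le_antisym[OF _ e_in, of y] le_bot by (auto intro: bexI[of _ "[]"])
next
  case (snoc t w)
  let ?z = "run e w"
  have z: "?z \<in> S" using snoc.prems by (auto intro: run_in e_in)
  have t: "t \<in> A" and w: "w \<in> lists A" using snoc.prems by auto
  have down: "le x ?z" if "x \<in> S" "act x t \<noteq> x" "le x (act ?z t)" for x
    using lifting[OF that(1) z t that(2) _ that(3)] that(3) by (cases "act ?z t = ?z") auto
  show ?case
  proof (cases "act y t = y")
    case False
    with down snoc.prems have "le y ?z" by auto
    with snoc.IH[OF w] snoc.prems show ?thesis
      by (blast intro: subseq_order.trans[of _ w])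
  next
    case True
    with pred_ex snoc.prems t obtain x where x: "x \<in> S" "x \<noteq> y" "act x t = y" by metis
    have "le x (act ?z t)" using le_act[OF x(1) t] x snoc.prems le_trans by auto
    with down x have "le x ?z" by auto
    with snoc.IH[OF w x(1)] obtain v where "v \<in> lists A" "run e v = x" "subseq v w"
      by auto
    then show ?thesis using x t by (intro bexI[of _ "v @ [t]"]) auto
  qed
qed

text \<open>Dropping the last letter of \<open>w\<close> gives a different, smaller element, which
  is therefore represented by a proper subword of \<open>v\<close>; the induction hypothesis bounds
  the length of that subword from below.\<close>

lemma strict_length_le:
  "\<lbrakk>strict e w; w \<in> lists A; v \<in> lists A; run e v = run e w\<rbrakk> \<Longrightarrow> length w \<le> length v"
proof (induction w arbitrary: v rule: rev_induct)
  case (snoc s w)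
  let ?y = "run e w"
  have w: "w \<in> lists A" "s \<in> A" "strict e w" "act ?y s \<noteq> ?y" using snoc.prems by auto
  then have y: "?y \<in> S" by (auto intro: run_in e_in)
  with w have "le ?y (run e v)" using snoc.prems le_act[of ?y s] by simp
  with subword_of_le snoc.prems y obtain v' where
    v': "v' \<in> lists A" "run e v' = ?y" "subseq v' v" by metis
  with w snoc.prems have "v' \<noteq> v" by auto
  with v' have "length v' < length v"
    by (metis list_emb_length le_neq_implies_less subseq_same_length)
  with snoc.IH[OF w(3,1) v'(1,2)] show ?case by simp
qed simp

lemma nonstrict_split:
  "\<not> strict x w \<Longrightarrow> \<exists>u s v. w = u @ s # v \<and> strict x u \<and> act (run x u) s = run x u"
proof (induction w rule: rev_induct)
  case (snoc s w)
  show ?case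
  proof (cases "strict x w")
    case True
    with snoc show ?thesis by (intro exI[of _ w] exI[of _ s] exI[of _ "[]"]) auto
  next
    case False
    with snoc.IH obtain u t v where "w = u @ t # v" "strict x u" "act (run x u) t = run x u"
      by auto
    then show ?thesis by (intro exI[of _ u] exI[of _ t] exI[of _ "v @ [s]"]) auto
  qed
qed simp

lemma reduced_iff_strict:
  assumes "w \<in> lists A"
  shows "reduced w \<longleftrightarrow> strict e w"
proof
  assume red: "reduced w"
  show "strict e w"
  proof (rule ccontr)
    assume "\<not> strict e w"
    then obtain u s v where uv: "w = u @ s # v" "act (run e u) s = run e u"
      using nonstrict_split by blast
    with assms have "u @ v \<in> lists A" "run e (u @ v) = run e w" by auto
    with red have "length w \<le> length (u @ v)" by blast
    with uv show False by simp
  qed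
qed (use assms strict_length_le in blast)

lemma run_delete_le:
  assumes "u @ s # v \<in> lists A"
  shows "le (run e (u @ v)) (run e (u @ s # v))"
  using assms by (auto intro!: run_mono le_act run_in act_in e_in)

text \<open>Some subword of \<open>w\<close> represents \<open>run e v\<close>. It is at least as
  long as the reduced word \<open>v\<close>, hence as \<open>w\<close>, so it is all of
  \<open>w\<close>.\<close>

lemma run_eq_of_le:
  assumes "reduced v" "w \<in> lists A" "length w \<le> length v" "le (run e v) (run e w)"
  shows "run e w = run e v"
proof -
  have "run e v \<in> S" using assms by (auto intro: run_in e_in)
  with subword_of_le assms obtain w' where
    w': "w' \<in> lists A" "run e w' = run e v" "subseq w' w" by metis
  then have "length v \<le> length w'" using assms by metis
  then have "length w' = length w" using assms list_emb_length[OF w'(3)] by simp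
  then have "w' = w" using w' subseq_same_length by blast
  with w' show ?thesis by simp
qed

lemma nearly_reduced_unique:
  assumes a: "a \<in> lists A" and nred: "\<not> reduced a"
    and m: "m \<in> {1..length a}" "reduced (delete_at m a)" "run e (delete_at m a) = \<tau>"
  shows "\<exists>!k. k \<noteq> m \<and> k \<in> {1..length a} \<and> reduced (delete_at k a) \<and> run e (delete_at k a) = \<tau>"
proof -
  define near where
    "near k \<longleftrightarrow> k \<in> {1..length a} \<and> reduced (delete_at k a) \<and> run e (delete_at k a) = \<tau>" for k
  have "\<not> strict e a" using a nred reduced_iff_strict by blast
  \<comment> \<open>\<open>t\<close> is the first letter that acts trivially; its position is
    \<open>?j\<close>.\<close>
  then obtain u t w where utw: "a = u @ t # w" "strict e u" "act (run e u) t = run e u"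
    using nonstrict_split by blast
  let ?j = "Suc (length u)"
  have u: "u \<in> lists A" "t \<in> A" "w \<in> lists A" using a utw by auto
  then have uS: "run e u \<in> S" by (auto intro: run_in e_in)
  have redI: "reduced v" if "v \<in> lists A" "run e v = \<tau>" "Suc (length v) = length a" for v
    using that m by (auto simp: delete_at_def)
  have "le \<tau> (run e a)"
    using m(1)
  proof (rule delete_at_split)
    fix u' c v' assume "a = u' @ c # v'" "delete_at m a = u' @ v'"
    then show ?thesis using m(3) run_delete_le[of u' c v'] a by auto
  qed
  \<comment> \<open>Since \<open>t\<close> acts trivially, \<open>u @ w\<close> evaluates like
    \<open>a\<close>, hence above \<tau>, and it is as long as the reduced word
    \<open>delete_at m a\<close>.\<close>
  then have "run e (u @ w) = \<tau>"
    using run_eq_of_le[OF m(2), of "u @ w"] u m(1,3) utw by (auto simp: delete_at_def)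
  then have near_j: "near ?j"
    using redI[of "u @ w"] u utw by (auto simp: near_def delete_at_append)
  \<comment> \<open>Deleting a position beyond \<open>?j\<close> keeps the prefix
    \<open>u @ [t]\<close>, in which \<open>t\<close> acts trivially.\<close>
  have le_j: "k \<le> ?j" if "near k" for k
  proof (rule ccontr)
    assume k: "\<not> k \<le> ?j"
    have "strict e (delete_at k a)"
      using that reduced_iff_strict unfolding near_def by blast
    moreover have "delete_at k a = u @ t # take (k - Suc ?j) w @ drop k a"
      using k utw by (simp add: delete_at_def take_Cons' Suc_diff_Suc)
    ultimately show False using utw by simp
  qed
  \<comment> \<open>After deleting a letter of \<open>u\<close>, the prefix ending in
    \<open>t\<close> is reduced, has the length of \<open>u\<close> and lies below
    \<open>run e u\<close>, so it represents the same element.\<close>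
  have below: "strict e (v1 @ v2 @ [t]) \<and> run e (v1 @ v2 @ [t]) = run e u"
    if "near k" "u = v1 @ c # v2" "k = Suc (length v1)" for k v1 c v2
  proof -
    have vl: "v1 \<in> lists A" "v2 \<in> lists A" "c \<in> A" using u that by auto
    have "delete_at k a = v1 @ v2 @ t # w" using that utw by (simp add: delete_at_append)
    then have st: "strict e (v1 @ v2 @ [t])"
      using that(1) reduced_iff_strict[of "delete_at k a"] unfolding near_def by auto
    then have "reduced (v1 @ v2 @ [t])"
      using reduced_iff_strict[of "v1 @ v2 @ [t]"] vl u by simp
    moreover have "le (run e (v1 @ v2 @ [t])) (run e u)"
      using run_delete_le[of v1 c "v2 @ [t]"] vl u utw that by auto
    ultimately show ?thesis using st run_eq_of_le[of "v1 @ v2 @ [t]" u] u that by auto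
  qed
  \<comment> \<open>A predecessor of \<open>run e u\<close> under \<open>t\<close> provides the
    second position: it comes from a proper subword \<open>v\<close> of \<open>u\<close>, and
    \<open>v @ [t]\<close> represents \<open>run e u\<close>, so \<open>v\<close> lacks exactly one
    letter.\<close>
  obtain y where y: "y \<in> S" "y \<noteq> run e u" "act y t = run e u"
    using pred_ex[OF uS u(2) utw(3)] by blast
  then have "le y (run e u)" using le_act[OF y(1) u(2)] by simp
  then obtain v where v: "v \<in> lists A" "run e v = y" "subseq v u"
    using subword_of_le u y by blast
  have "length u \<le> length (v @ [t])" using strict_length_le[of u "v @ [t]"] utw u v y by auto
  moreover have "length v < length u"
    using v y by (metis list_emb_length le_neq_implies_less subseq_same_length)
  ultimately have "length u = Suc (length v)" by simp
  then obtain u1 c u2 where u12: "u = u1 @ c # u2" "v = u1 @ u2"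
    using subseq_delete_one v by blast
  let ?k = "Suc (length u1)"
  have "run e (u1 @ u2 @ t # w) = \<tau>"
    using \<open>run e (u @ w) = \<tau>\<close> v y u12 by simp
  then have near_k: "near ?k"
    using redI[of "u1 @ u2 @ t # w"] u u12 utw by (auto simp: near_def delete_at_append)
  \<comment> \<open>For two such positions inside \<open>u\<close>, both prefixes end in
    \<open>u3 @ [t]\<close>. Cancelling this identifies \<open>run e (u1 @ u2 @ [c'])\<close> with
    \<open>run e (u1 @ c # u2)\<close>, so \<open>c'\<close> would act trivially at its place in
    \<open>u\<close>.\<close>
  have False if "near k" "near k'" "k < k'" "k' < ?j" for k k'
  proof -
    have "k' \<in> {1..length u}" using that by (auto simp: near_def)
    then obtain v' c' u3 where 1: "u = v' @ c' # u3" "k' = Suc (length v')"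
      by (rule delete_at_split)
    have "k \<in> {1..length v'}" using that 1 by (auto simp: near_def)
    then obtain u1 c u2 where 2: "v' = u1 @ c # u2" "k = Suc (length u1)"
      by (rule delete_at_split)
    have A: "u1 \<in> lists A" "c \<in> A" "u2 \<in> lists A" "c' \<in> A" "u3 \<in> lists A"
      using u 1 2 by auto
    have b1: "strict e (u1 @ (u2 @ c' # u3) @ [t])" "run e (u1 @ (u2 @ c' # u3) @ [t]) = run e u"
      using below[OF that(1), of u1 c "u2 @ c' # u3"] 1 2 by auto
    have b2: "strict e ((u1 @ c # u2) @ u3 @ [t])" "run e ((u1 @ c # u2) @ u3 @ [t]) = run e u"
      using below[OF that(2), of "u1 @ c # u2" c' u3] 1 2 by auto
    have "run e (u1 @ u2 @ [c']) = run e (u1 @ c # u2)"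
      by (rule strict_run_inj[of _ _ "u3 @ [t]"]) (use A b1 b2 u in \<open>auto intro!: run_in act_in e_in\<close>)
    moreover have "act (run e (u1 @ u2 @ [c'])) c' = run e (u1 @ u2 @ [c'])"
      using A by (auto intro!: act_idem run_in e_in)
    ultimately show False using utw(2) 1 2 by simp
  qed
  then have two: "k = ?k \<or> k = ?j" if "near k" for k
    using that le_j[OF that] near_k u12 by (metis length_append length_Cons less_add_Suc1 linorder_neqE_nat
        le_neq_implies_less Suc_less_eq add_Suc_right)
  have "?k \<noteq> ?j" using u12 by simp
  moreover have "near m" using m by (simp add: near_def)
  ultimately have "\<exists>!k. k \<noteq> m \<and> near k" using near_j near_k two by metis
  then show ?thesis by (simp add: near_def)
qed

end

section \<open>Rank matrices\<close>

lemma adj_simps [simp]: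
  "adj s s = Suc s" "adj s (Suc s) = s" "v \<noteq> s \<Longrightarrow> v \<noteq> Suc s \<Longrightarrow> adj s v = v"
  "adj s (adj s v) = v" "adj s \<circ> adj s = id"
  by (auto simp: adj_def)

lemma adj_eq_iff [simp]: "adj s u = adj s v \<longleftrightarrow> u = v"
  by (metis adj_simps(4))

lemma adj_permutes: "s \<in> {1..<n} \<Longrightarrow> adj s permutes {1..n}"
  unfolding adj_def by (rule permutes_swap_id) auto

lemma adj_in_iff [simp]: "s \<in> {1..<n} \<Longrightarrow> adj s v \<in> {1..n} \<longleftrightarrow> v \<in> {1..n}"
  using permutes_in_image[OF adj_permutes] by blast

lemma less_adj_iff: "j \<noteq> s \<Longrightarrow> j < adj s v \<longleftrightarrow> j < v"
  by (cases "v = s"; cases "v = Suc s") auto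

lemma adj_le_iff: "i \<noteq> s \<Longrightarrow> adj s v \<le> i \<longleftrightarrow> v \<le> i"
  by (cases "v = s"; cases "v = Suc s") auto

text \<open>
  A function \<open>P\<close> with values in \<open>{0..n+1}\<close> stands for a 0-1 matrix: the 1 of row \<open>a\<close> is in column
  \<open>P a\<close>, where \<open>0\<close> means that there is none and column \<open>n+1\<close> is a margin, and dually the 1 of
  column \<open>c\<close> is in row \<open>P c\<close>, where row \<open>0\<close> is a margin. The rank \<open>place_rank n P i j\<close> counts the
  ones in rows \<open>0..i\<close> and columns \<open>j+1..n+1\<close>.
\<close>

definition place_rank :: "nat \<Rightarrow> (nat \<Rightarrow> nat) \<Rightarrow> nat \<Rightarrow> nat \<Rightarrow> nat" where
  "place_rank n P i j =
     (\<Sum>c = 1..n. of_bool (j < c \<and> P c = 0) + of_bool (c \<le> i \<and> j < P c))"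

text \<open>A partial involution: inside the margins the matrix is symmetric, so that
  \<open>P\<close> can be read both by rows and by columns.\<close>

definition is_place :: "nat \<Rightarrow> (nat \<Rightarrow> nat) \<Rightarrow> bool" where
  "is_place n P \<longleftrightarrow> (\<forall>c \<in> {1..n}. P c \<le> Suc n \<and> (P c \<in> {1..n} \<longrightarrow> P (P c) = c))"

text \<open>The strict inequality sends equal entries to the last branch. In a place, equal entries
  lie in a margin, where conjugation would change nothing.\<close>

definition place_step :: "nat \<Rightarrow> (nat \<Rightarrow> nat) \<Rightarrow> nat \<Rightarrow> nat" where
  "place_step s P =
     (if P s < P (Suc s)
      then if P s = s \<and> P (Suc s) = Suc s then P \<circ> adj s else adj s \<circ> P \<circ> adj s
      else P)"

lemma place_rank_row:
  assumes "i < n"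
  shows "place_rank n P (Suc i) j = place_rank n P i j + of_bool (j < P (Suc i))"
proof -
  have "of_bool (c \<le> Suc i \<and> j < P c)
      = of_bool (c \<le> i \<and> j < P c) + (if c = Suc i then of_bool (j < P (Suc i)) else (0::nat))" for c
    by (auto simp: le_Suc_eq)
  then show ?thesis
    using assms by (simp add: place_rank_def sum.distrib)
qed

text \<open>By the involution property, the 1 of column \<open>Suc j\<close> is in row
  \<open>P (Suc j)\<close>. Row \<open>0\<close> is counted by the first summand of
  \<open>place_rank\<close>, and \<open>i \<le> n\<close> excludes \<open>Suc n\<close>, which
  stands for no 1.\<close>

lemma place_rank_col:
  assumes "is_place n P" "j < n" "i \<le> n"
  shows "place_rank n P i j = place_rank n P i (Suc j) + of_bool (P (Suc j) \<le> i)"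
proof -
  have 1: "of_bool (j < c \<and> P c = 0)
      = of_bool (Suc j < c \<and> P c = 0) + (if c = Suc j then of_bool (P (Suc j) = 0) else (0::nat))" for c
    by auto
  have 2: "of_bool (c \<le> i \<and> j < P c)
      = of_bool (c \<le> i \<and> Suc j < P c) + (if c = P (Suc j) then of_bool (c \<le> i) else (0::nat))"
    if "c \<in> {1..n}" for c
  proof -
    have "P c = Suc j \<longleftrightarrow> c = P (Suc j)"
      using assms that unfolding is_place_def by (metis Suc_leI atLeastAtMost_iff le_add1 plus_1_eq_Suc)
    then show ?thesis by (cases "P c = Suc j") auto
  qed
  have "place_rank n P i j = (\<Sum>c = 1..n.
      (of_bool (Suc j < c \<and> P c = 0) + of_bool (c \<le> i \<and> Suc j < P c))
      + ((if c = Suc j then of_bool (P (Suc j) = 0) else 0)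
      + (if c = P (Suc j) then of_bool (c \<le> i) else 0)))"
    unfolding place_rank_def by (intro sum.cong refl) (simp only: 1 2)
  also have "\<dots> = place_rank n P i (Suc j) + (of_bool (P (Suc j) = 0)
      + (if P (Suc j) \<in> {1..n} then of_bool (P (Suc j) \<le> i) else 0))"
    unfolding place_rank_def sum.distrib using assms(2) by (simp add: sum.delta)
  also have "\<dots> = place_rank n P i (Suc j) + of_bool (P (Suc j) \<le> i)"
  proof -
    have "P (Suc j) \<le> Suc n" using assms unfolding is_place_def by auto
    then show ?thesis using assms(3) by auto
  qed
  finally show ?thesis .
qed

text \<open>Differences of adjacent columns decide \<open>P c \<le> i\<close> for all
  \<open>i \<le> n\<close>, which determines a number that is at most \<open>Suc n\<close>.\<close>

lemma place_rank_inj: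
  assumes "is_place n P" "is_place n Q"
    and eq: "\<And>i j. i \<le> n \<Longrightarrow> j \<le> n \<Longrightarrow> place_rank n P i j = place_rank n Q i j"
    and c: "c \<in> {1..n}"
  shows "P c = Q c"
proof -
  obtain j where j: "c = Suc j" "j < n" using c by (cases c) auto
  have "P c \<le> i \<longleftrightarrow> Q c \<le> i" if "i \<le> n" for i
    using place_rank_col[OF assms(1) j(2) that] place_rank_col[OF assms(2) j(2) that]
      eq[of i j] eq[of i "Suc j"] that j by (auto split: if_splits simp: of_bool_def)
  moreover have "P c \<le> Suc n" "Q c \<le> Suc n" using assms c unfolding is_place_def by auto
  ultimately show ?thesis
    by (metis le_Suc_eq le_antisym order_refl)
qed

lemma is_place_step:
  assumes "is_place n P" "s \<in> {1..<n}"
  shows "is_place n (place_step s P)"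
proof -
  have "is_place n (adj s \<circ> P \<circ> adj s)"
  proof -
    have "adj s (P (adj s c)) \<le> Suc n" if "c \<in> {1..n}" for c
    proof -
      have "adj s c \<in> {1..n}" using adj_in_iff[OF assms(2)] that by blast
      then have "P (adj s c) \<le> Suc n" using assms(1) unfolding is_place_def by blast
      then show ?thesis using assms(2) by (simp add: adj_le_iff)
    qed
    moreover have "adj s (P (P (adj s c))) = c"
      if c: "c \<in> {1..n}" "adj s (P (adj s c)) \<in> {1..n}" for c
    proof -
      have "adj s c \<in> {1..n}" "P (adj s c) \<in> {1..n}" using adj_in_iff[OF assms(2)] c by blast+
      then have "P (P (adj s c)) = adj s c" using assms(1) unfolding is_place_def by blast
      then show ?thesis by simp
    qed
    ultimately show ?thesis unfolding is_place_def by auto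
  qed
  moreover have "is_place n (P \<circ> adj s)" if "P s = s" "P (Suc s) = Suc s"
    unfolding is_place_def
  proof
    fix c assume c: "c \<in> {1..n}"
    then have Pc: "P c \<le> Suc n" "P c \<in> {1..n} \<Longrightarrow> P (P c) = c"
      using assms(1) unfolding is_place_def by blast+
    consider "c = s" | "c = Suc s" | "c \<noteq> s" "c \<noteq> Suc s" by blast
    then show "(P \<circ> adj s) c \<le> Suc n \<and>
        ((P \<circ> adj s) c \<in> {1..n} \<longrightarrow> (P \<circ> adj s) ((P \<circ> adj s) c) = c)"
    proof cases
      case 3
      then have "P c \<in> {1..n} \<Longrightarrow> P c \<noteq> s \<and> P c \<noteq> Suc s" using Pc that by auto
      then show ?thesis using Pc 3 by auto
    qed (use that assms(2) in auto)
  qed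
  ultimately show ?thesis using assms unfolding place_step_def by auto
qed

text \<open>A bound different from \<open>s\<close> does not separate \<open>s\<close> from
  \<open>Suc s\<close>, so reindexing the sum by \<open>adj s\<close> matches the summands.\<close>

lemma place_rank_step_far:
  assumes "s \<in> {1..<n}" "i \<noteq> s" "j \<noteq> s"
  shows "place_rank n (place_step s P) i j = place_rank n P i j"
proof -
  have bij: "bij_betw (adj s) {1..n} {1..n}"
    using adj_permutes[OF assms(1)] by (simp add: permutes_imp_bij)
  have "0 < s" using assms by auto
  then have z: "adj s x = 0 \<longleftrightarrow> x = 0" for x by (cases "x = s"; cases "x = Suc s") auto
  have "place_rank n (adj s \<circ> P \<circ> adj s) i j = place_rank n P i j"
    unfolding place_rank_def sum.reindex_bij_betw[OF bij, symmetric, of "\<lambda>c. of_bool (j < c \<and> P c = 0) + _ c"]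
    by (intro sum.cong refl) (use assms in \<open>simp add: less_adj_iff adj_le_iff z\<close>)
  moreover have "place_rank n (P \<circ> adj s) i j = place_rank n P i j"
    unfolding place_rank_def sum.reindex_bij_betw[OF bij, symmetric, of "\<lambda>c. of_bool (j < c \<and> P c = 0) + _ c"]
    by (intro sum.cong refl) (use assms in \<open>simp add: less_adj_iff adj_le_iff z\<close>)
  ultimately show ?thesis by (auto simp: place_step_def)
qed

text \<open>
  Sorting two adjacent rows or columns of a 0-1 matrix is a monotone operation on its rank matrix:
  it changes a single row or column of ranks, and the new entries are these minima (maxima, for
  the opposite sorting).
\<close>

definition col_up :: "nat \<Rightarrow> (nat \<Rightarrow> nat \<Rightarrow> nat) \<Rightarrow> nat \<Rightarrow> nat \<Rightarrow> nat" where
  "col_up s N i j = (if j = s then min (N i (s - 1)) (N i (Suc s) + 1) else N i j)"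

definition row_up :: "nat \<Rightarrow> (nat \<Rightarrow> nat \<Rightarrow> nat) \<Rightarrow> nat \<Rightarrow> nat \<Rightarrow> nat" where
  "row_up s N i j = (if i = s then min (N (s - 1) j + 1) (N (Suc s) j) else N i j)"

definition col_down :: "nat \<Rightarrow> (nat \<Rightarrow> nat \<Rightarrow> nat) \<Rightarrow> nat \<Rightarrow> nat \<Rightarrow> nat" where
  "col_down s N i j = (if j = s then max (N i (s - 1) - 1) (N i (Suc s)) else N i j)"

definition row_down :: "nat \<Rightarrow> (nat \<Rightarrow> nat \<Rightarrow> nat) \<Rightarrow> nat \<Rightarrow> nat \<Rightarrow> nat" where
  "row_down s N i j = (if i = s then max (N (s - 1) j) (N (Suc s) j - 1) else N i j)"

definition up_op :: "nat \<Rightarrow> (nat \<Rightarrow> nat \<Rightarrow> nat) \<Rightarrow> nat \<Rightarrow> nat \<Rightarrow> nat" where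
  "up_op s N = row_up s (col_up s N)"

definition down_op :: "nat \<Rightarrow> (nat \<Rightarrow> nat \<Rightarrow> nat) \<Rightarrow> nat \<Rightarrow> nat \<Rightarrow> nat" where
  "down_op s N = row_down s (col_down s N)"

lemmas op_defs = up_op_def down_op_def row_up_def col_up_def row_down_def col_down_def

definition le_upto :: "nat \<Rightarrow> (nat \<Rightarrow> nat \<Rightarrow> nat) \<Rightarrow> (nat \<Rightarrow> nat \<Rightarrow> nat) \<Rightarrow> bool" where
  "le_upto n N N' \<longleftrightarrow> (\<forall>i \<le> n. \<forall>j \<le> n. N i j \<le> N' i j)"

lemma
  assumes "le_upto n N N'" "s \<in> {1..<n}"
  shows col_up_mono: "le_upto n (col_up s N) (col_up s N')"
    and row_up_mono: "le_upto n (row_up s N) (row_up s N')"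
    and col_down_mono: "le_upto n (col_down s N) (col_down s N')"
    and row_down_mono: "le_upto n (row_down s N) (row_down s N')"
proof -
  have *: "N i j \<le> N' i j" "N (s - 1) j \<le> N' (s - 1) j" "N (Suc s) j \<le> N' (Suc s) j"
    "N i (s - 1) \<le> N' i (s - 1)" "N i (Suc s) \<le> N' i (Suc s)" if "i \<le> n" "j \<le> n" for i j
    using assms that by (auto simp: le_upto_def)
  show "le_upto n (col_up s N) (col_up s N')"
    unfolding le_upto_def
  proof (intro allI impI)
    fix i j assume "i \<le> n" "j \<le> n"
    from *[OF this] show "col_up s N i j \<le> col_up s N' i j"
      by (cases "j = s"; simp only: col_up_def simp_thms if_True if_False; linarith)
  qed
  show "le_upto n (row_up s N) (row_up s N')"
    unfolding le_upto_def
  proof (intro allI impI)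
    fix i j assume "i \<le> n" "j \<le> n"
    from *[OF this] show "row_up s N i j \<le> row_up s N' i j"
      by (cases "i = s"; simp only: row_up_def simp_thms if_True if_False; linarith)
  qed
  show "le_upto n (col_down s N) (col_down s N')"
    unfolding le_upto_def
  proof (intro allI impI)
    fix i j assume "i \<le> n" "j \<le> n"
    from *[OF this] show "col_down s N i j \<le> col_down s N' i j"
      by (cases "j = s"; simp only: col_down_def simp_thms if_True if_False; linarith)
  qed
  show "le_upto n (row_down s N) (row_down s N')"
    unfolding le_upto_def
  proof (intro allI impI)
    fix i j assume "i \<le> n" "j \<le> n"
    from *[OF this] show "row_down s N i j \<le> row_down s N' i j"
      by (cases "i = s"; simp only: row_down_def simp_thms if_True if_False; linarith)
  qed
qed

lemma up_op_mono: "le_upto n N N' \<Longrightarrow> s \<in> {1..<n} \<Longrightarrow> le_upto n (up_op s N) (up_op s N')"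
  by (simp add: up_op_def row_up_mono col_up_mono)

lemma down_op_mono: "le_upto n N N' \<Longrightarrow> s \<in> {1..<n} \<Longrightarrow> le_upto n (down_op s N) (down_op s N')"
  by (simp add: down_op_def row_down_mono col_down_mono)

text \<open>The ranks around row and column \<open>s\<close> are expressed by one rank and the
  entries \<open>P s\<close> and \<open>P (Suc s)\<close>, which turns
  \<open>place_rank_step\<close> into a finite check.\<close>

lemma place_step_eqs:
  assumes P: "is_place n P" and s: "s = Suc t" "s < n" and ij: "i \<le> n" "j \<le> n"
  defines "N \<equiv> place_rank n P"
  shows "N s j = N t j + of_bool (j < P s)"
    and "N (Suc s) j = N t j + of_bool (j < P s) + of_bool (j < P (Suc s))"
    and "N i s = N i (Suc s) + of_bool (P (Suc s) \<le> i)"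
    and "N i t = N i (Suc s) + of_bool (P (Suc s) \<le> i) + of_bool (P s \<le> i)"
  using place_rank_row[of t n P j] place_rank_row[of s n P j] place_rank_col[OF P, of t i]
    place_rank_col[OF P, of s i] s ij unfolding N_def by auto

text \<open>Only row \<open>s\<close> and column \<open>s\<close> of the ranks can change, and their
  new values follow from unchanged neighbours. The four claims share the case analysis on
  \<open>(i, j)\<close> relative to \<open>s\<close>.\<close>

lemma place_rank_step:
  assumes P: "is_place n P" and s: "s \<in> {1..<n}" and ij: "i \<le> n" "j \<le> n"
  shows up_op_place: "up_op s (place_rank n P) i j = place_rank n (place_step s P) i j" (is ?up)
    and place_rank_step_ge: "place_rank n P i j \<le> place_rank n (place_step s P) i j" (is ?ge)
    and down_op_place: "P s \<le> P (Suc s) \<Longrightarrow> down_op s (place_rank n P) i j = place_rank n P i j"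
      (is "_ \<Longrightarrow> ?dn")
    and down_op_step: "P s \<le> P (Suc s) \<Longrightarrow>
      down_op s (place_rank n (place_step s P)) i j = place_rank n P i j"
      (is "_ \<Longrightarrow> ?dn'")
proof -
  obtain t where t: "s = Suc t" "s < n" using s by (cases s) auto
  let ?Q = "place_step s P"
  let ?N = "place_rank n P" and ?N' = "place_rank n ?Q"
  note Peqs = place_step_eqs[OF P t] and Qeqs = place_step_eqs[OF is_place_step[OF P s] t]
  note far = place_rank_step_far[OF s, where P = P]
  have bnd: "i \<le> n" "j \<le> n" "t \<le> n" "s \<le> n" "Suc s \<le> n" using t ij by auto
  have inv: "c \<in> {1..n} \<Longrightarrow> P c \<in> {1..n} \<Longrightarrow> P (P c) = c" for c
    using P unfolding is_place_def by blast
  \<comment> \<open>No two rows share a 1 in column \<open>s\<close> or \<open>Suc s\<close>, and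
    pairing \<open>s\<close> with \<open>Suc s\<close> is symmetric; this limits the cases at the
    corner \<open>(s, s)\<close>.\<close>
  have p: "P s = Suc s \<longleftrightarrow> P (Suc s) = s" "P s \<noteq> s \<or> P (Suc s) \<noteq> s" "P (Suc s) \<noteq> Suc s \<or> P s \<noteq> Suc s"
    using inv[of s] inv[of "Suc s"] bnd s by auto
  have Q: "?Q s = (if P s < P (Suc s) then if P s = s \<and> P (Suc s) = Suc s then Suc s
             else adj s (P (Suc s)) else P s)"
    "?Q (Suc s) = (if P s < P (Suc s) then if P s = s \<and> P (Suc s) = Suc s then s
             else adj s (P s) else P (Suc s))"
    by (auto simp: place_step_def)
  have adj: "adj s x = (if x = s then Suc s else if x = Suc s then s else x)" for x by simp
  have all: "?up \<and> ?ge \<and> (P s \<le> P (Suc s) \<longrightarrow> ?dn \<and> ?dn')"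
  proof (cases "P s < P (Suc s)")
    case True
    note Q' = Q[unfolded adj]
    consider "i \<noteq> s" "j \<noteq> s" | "i \<noteq> s" "j = s" | "i = s" "j \<noteq> s" | "i = s" "j = s" by auto
    then show ?thesis
    proof cases
      case 1
      then show ?thesis by (simp add: far op_defs)
    next
      case 2
      have "?N' i (Suc s) = ?N i (Suc s)" "?N' i t = ?N i t"
        using far[of i "Suc s"] far[of i t] 2 t by auto
      then show ?thesis
        using Peqs(3,4)[OF bnd(1) bnd(1)] Qeqs(3)[OF bnd(1) bnd(1)] True 2 p Q' t
        by (auto simp: op_defs of_bool_def split: if_splits)
    next
      case 3
      have "?N' t j = ?N t j" "?N' (Suc s) j = ?N (Suc s) j"
        using far[of t j] far[of "Suc s" j] 3 t by auto
      then show ?thesis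
        using Peqs(1,2)[OF bnd(2) bnd(2)] Qeqs(1)[OF bnd(2) bnd(2)] True 3 p Q' t
        by (auto simp: op_defs of_bool_def split: if_splits)
    next
      case 4
      \<comment> \<open>The rank at \<open>(s, s)\<close> is computed from the four ranks diagonal
        to it, which the step preserves.\<close>
      have "?N' x y = ?N x y" if "x \<in> {t, Suc s}" "y \<in> {t, Suc s}" for x y
        using far[of x y] that t by auto
      then have far': "?N' t t = ?N t t" "?N' t (Suc s) = ?N t (Suc s)"
        "?N' (Suc s) t = ?N (Suc s) t" "?N' (Suc s) (Suc s) = ?N (Suc s) (Suc s)" by auto
      note E = Peqs(1)[OF bnd(4,4)] Peqs(2)[OF bnd(4,5)] Peqs(3,4)[OF bnd(3,4)]
        Peqs(4)[OF bnd(5,4)] Qeqs(1)[OF bnd(4,4)] Qeqs(3)[OF bnd(3,4)]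
      have ne: "P s \<noteq> Suc s" "P (Suc s) \<noteq> s" using p True by auto
      consider (a) "P s < s" "P (Suc s) < s" | (b) "P s < s" "P (Suc s) = Suc s"
        | (c) "P s < s" "P (Suc s) > Suc s" | (d) "P s = s" "P (Suc s) = Suc s"
        | (e) "P s = s" "P (Suc s) > Suc s" | (f) "P s > Suc s" "P (Suc s) > Suc s"
        using True ne by linarith
      then show ?thesis
        by cases (use far' E Q True 4 t in \<open>simp add: op_defs\<close>)+
    qed
  next
    case False
    then have "?Q = P" by (simp add: place_step_def)
    consider "i \<noteq> s" "j \<noteq> s" | "i \<noteq> s" "j = s" | "i = s" "j \<noteq> s" | "i = s" "j = s" by auto
    then show ?thesis
    proof cases
      case 1
      then show ?thesis using \<open>?Q = P\<close> by (simp add: op_defs)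
    next
      case 2
      then show ?thesis
        using Peqs(3,4)[OF bnd(1) bnd(1)] False t \<open>?Q = P\<close>
        by (auto simp: op_defs of_bool_def split: if_splits)
    next
      case 3
      then show ?thesis
        using Peqs(1,2)[OF bnd(2) bnd(2)] False t \<open>?Q = P\<close>
        by (auto simp: op_defs of_bool_def split: if_splits)
    next
      case 4
      note E = Peqs(1)[OF bnd(4,4)] Peqs(2)[OF bnd(4,5)] Peqs(3,4)[OF bnd(3,4)]
        Peqs(4)[OF bnd(5,4)]
      consider (a) "P s < s" "P (Suc s) < s" | (b) "P s = s" "P (Suc s) < s"
        | (c) "P s > Suc s" "P (Suc s) < s" | (d) "P s = Suc s" "P (Suc s) = s"
        | (e) "P s > Suc s" "P (Suc s) = Suc s" | (f) "P s > Suc s" "P (Suc s) > Suc s"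
      proof (cases "P s = Suc s")
        case True
        with p that(4) show ?thesis by simp
      next
        case ne: False
        then have "P (Suc s) \<noteq> s" using p by simp
        with ne False that show ?thesis by linarith
      qed
      then show ?thesis
        by cases (use E False 4 t \<open>?Q = P\<close> in \<open>simp add: op_defs\<close>)+
    qed
  qed
  show ?up ?ge "P s \<le> P (Suc s) \<Longrightarrow> ?dn" "P s \<le> P (Suc s) \<Longrightarrow> ?dn'" using all by blast+
qed

section \<open>The ordered set of states\<close>

type_synonym state = "(nat \<Rightarrow> nat) \<times> (nat \<Rightarrow> nat)"

text \<open>
  The block sizes are prescribed by a second block assignment \<open>b0\<close>; the normalization \<open>b v = 0\<close>
  outside \<open>{1..n}\<close> makes equality of states extensional.
\<close>

definition states :: "nat \<Rightarrow> (nat \<Rightarrow> nat) \<Rightarrow> state set" where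
  "states n b0 = {(b, y). y permutes {1..n} \<and> y \<circ> y = id \<and> b \<circ> y = b \<and>
     (\<forall>v. v \<notin> {1..n} \<longrightarrow> b v = 0) \<and>
     (\<forall>r. card {v \<in> {1..n}. b v < r} = card {v \<in> {1..n}. b0 v < r})}"

definition ascent :: "state \<Rightarrow> nat \<Rightarrow> bool" where
  "ascent = (\<lambda>(b, y) s. b s < b (Suc s) \<or> b s = b (Suc s) \<and> y s < y (Suc s))"

text \<open>If \<open>y\<close> fixes both values, it commutes with \<open>adj s\<close>;
  conjugation would do nothing, and the two-sided 0-Hecke product multiplies by \<open>adj s\<close>
  only once.\<close>

definition state_step :: "state \<Rightarrow> nat \<Rightarrow> state" where
  "state_step = (\<lambda>(b, y) s.
     if ascent (b, y) s
     then if b s = b (Suc s) \<and> y s = s \<and> y (Suc s) = Suc s then (b, y \<circ> adj s)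
          else (b \<circ> adj s, adj s \<circ> y \<circ> adj s)
     else (b, y))"

text \<open>
  The \<open>r\<close>th matrix contains the permutation matrix of the \<open>r\<close>th involution; the values of the
  blocks before and after it go to the two margins.
\<close>

definition place :: "nat \<Rightarrow> state \<Rightarrow> nat \<Rightarrow> nat \<Rightarrow> nat" where
  "place n = (\<lambda>(b, y) r v. if b v < r then 0 else if b v = r then y v else Suc n)"

definition state_le :: "nat \<Rightarrow> state \<Rightarrow> state \<Rightarrow> bool" where
  "state_le n x x' \<longleftrightarrow> (\<forall>r. le_upto n (place_rank n (place n x r)) (place_rank n (place n x' r)))"

lemma adj_less_iff:
  "{u, v} \<noteq> {s, Suc s} \<Longrightarrow> adj s u < adj s v \<longleftrightarrow> u < v"
  by (cases "u = s"; cases "u = Suc s"; cases "v = s"; cases "v = Suc s") auto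

lemma is_place_place: "x \<in> states n b0 \<Longrightarrow> is_place n (place n x r)"
proof -
  assume "x \<in> states n b0"
  then obtain b y where x: "x = (b, y)" and y: "y permutes {1..n}" "y \<circ> y = id" "b \<circ> y = b"
    by (auto simp: states_def)
  have "y v \<in> {1..n}" "y (y v) = v" "b (y v) = b v" if "v \<in> {1..n}" for v
    using permutes_in_image[OF y(1)] y(2,3) that by (auto simp: fun_eq_iff)
  moreover from this(1) have "y v \<le> Suc n" if "v \<in> {1..n}" for v
    using that by (meson atLeastAtMost_iff le_SucI)
  ultimately show ?thesis unfolding is_place_def place_def x by auto
qed

text \<open>The entries grow with the block and, inside block \<open>r\<close>, with
  \<open>y\<close>. The inequalities are weak because values on the same side of block
  \<open>r\<close> share a margin.\<close>

lemma place_consecutive: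
  assumes x: "x \<in> states n b0" and s: "s \<in> {1..<n}"
  shows ascent_place_le: "ascent x s \<Longrightarrow> place n x r s \<le> place n x r (Suc s)"
    and descent_place_ge: "\<not> ascent x s \<Longrightarrow> place n x r (Suc s) \<le> place n x r s"
proof -
  obtain b y where xy: "x = (b, y)" by force
  have *: "y s \<le> Suc n" "y (Suc s) \<le> Suc n"
    using x s permutes_in_image[of y "{1..n}" s] permutes_in_image[of y "{1..n}" "Suc s"]
    by (auto simp: states_def xy)
  show "ascent x s \<Longrightarrow> place n x r s \<le> place n x r (Suc s)"
    using * unfolding xy place_def ascent_def prod.case
    by (cases "b s" r rule: linorder_cases; cases "b (Suc s)" r rule: linorder_cases; simp)
  show "\<not> ascent x s \<Longrightarrow> place n x r (Suc s) \<le> place n x r s"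
    using * unfolding xy place_def ascent_def prod.case
    by (cases "b s" r rule: linorder_cases; cases "b (Suc s)" r rule: linorder_cases; simp)
qed

text \<open>This reduces the properties of \<open>state_le\<close> to statements about rank
  matrices, separately for each \<open>r\<close>.\<close>

lemma place_state_step:
  assumes x: "x \<in> states n b0" and s: "s \<in> {1..<n}"
  shows "place n (state_step x s) r = place_step s (place n x r)"
proof (cases "ascent x s")
  case False
  then show ?thesis using descent_place_ge[OF x s False, of r]
    by (auto simp: state_step_def place_step_def split: prod.splits)
next
  case True
  obtain b y where xy: "x = (b, y)" by force
  let ?P = "place n x r"
  have big: "adj s 0 = 0" "adj s (Suc n) = Suc n" using s by auto
  have yr: "1 \<le> y v" "y v \<le> n" if "v \<in> {1..n}" for v
    using x xy permutes_in_image[of y "{1..n}" v] that by (auto simp: states_def)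
  consider (fixed) "b s = b (Suc s)" "y s = s" "y (Suc s) = Suc s"
    | (generic) "\<not> (b s = b (Suc s) \<and> y s = s \<and> y (Suc s) = Suc s)" by blast
  then show ?thesis
  proof cases
    case fixed
    then have st: "state_step x s = (b, y \<circ> adj s)" using True xy by (simp add: state_step_def)
    show ?thesis
    proof
      fix v
      consider "v = s" | "v = Suc s" | "v \<noteq> s" "v \<noteq> Suc s" by blast
      then show "place n (state_step x s) r v = place_step s ?P v"
        unfolding st by cases (use fixed big xy s in \<open>auto simp: place_def place_step_def\<close>)
    qed
  next
    case generic
    then have st: "state_step x s = (b \<circ> adj s, adj s \<circ> y \<circ> adj s)"
      using True xy generic by (simp only: state_step_def prod.case if_True if_False)
    have 1: "place n (state_step x s) r = adj s \<circ> ?P \<circ> adj s"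
      by (subst st) (use big xy in \<open>auto simp: place_def fun_eq_iff\<close>)
    show ?thesis
    proof (cases "?P s < ?P (Suc s)")
      case True
      have "\<not> (?P s = s \<and> ?P (Suc s) = Suc s)"
        using generic s xy by (auto simp: place_def split: if_splits)
      with True 1 show ?thesis by (simp only: place_step_def if_True if_False)
    next
      \<comment> \<open>An ascent that the \<open>r\<close>th matrix does not see has both values in
        the same margin. No other row has its 1 in column \<open>s\<close> or \<open>Suc s\<close>,
        so conjugation changes nothing.\<close>
      case False
      with ascent_place_le[OF x s \<open>ascent x s\<close>, of r] have eq: "?P s = ?P (Suc s)" by simp
      have "b s \<noteq> r \<or> b (Suc s) \<noteq> r" using eq True xy by (auto simp: place_def ascent_def split: if_splits)
      then have "?P s = 0 \<or> ?P s = Suc n"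
        using eq xy s yr[of s] yr[of "Suc s"] by (auto simp: place_def split: if_splits)
      have "(adj s \<circ> ?P \<circ> adj s) v = ?P v" for v
      proof (cases "v \<in> {1..n}")
        case True
        then have "?P v \<in> {1..n} \<Longrightarrow> ?P (?P v) = v"
          using is_place_place[OF x] unfolding is_place_def by blast
        then have ne: "?P v \<noteq> s" "?P v \<noteq> Suc s" if "v \<noteq> s" "v \<noteq> Suc s"
          using \<open>?P s = 0 \<or> ?P s = Suc n\<close> eq s True by auto
        have fixP: "adj s (?P s) = ?P s"
          using \<open>?P s = 0 \<or> ?P s = Suc n\<close> by (elim disjE) (simp_all only: big)
        consider "v = s" | "v = Suc s" | "v \<noteq> s" "v \<noteq> Suc s" by blast
        then show ?thesis
        proof cases
          case 3
          then show ?thesis using ne by simp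
        qed (simp_all only: comp_apply adj_simps(1,2) eq[symmetric] fixP)
      next
        case False
        have "y permutes {1..n}" using x xy by (simp add: states_def)
        then have "y v = v" using False by (rule permutes_not_in)
        moreover have "v \<noteq> s" "v \<noteq> Suc s" using False s by auto
        ultimately show ?thesis using big xy by (simp add: place_def)
      qed
      with 1 False show ?thesis by (auto simp: place_step_def)
    qed
  qed
qed

lemma states_conj:
  assumes x: "(b, y) \<in> states n b0" and s: "s \<in> {1..<n}"
  shows "(b \<circ> adj s, adj s \<circ> y \<circ> adj s) \<in> states n b0"
proof -
  have "card {v \<in> {1..n}. b (adj s v) < r} = card {v \<in> {1..n}. b v < r}" for r
  proof (rule bij_betw_same_card)
    show "bij_betw (adj s) {v \<in> {1..n}. b (adj s v) < r} {v \<in> {1..n}. b v < r}"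
      by (rule bij_betwI[where g = "adj s"]) (use adj_in_iff[OF s] in auto)
  qed
  moreover have "adj s \<circ> y \<circ> adj s permutes {1..n}"
    using x s by (intro permutes_compose adj_permutes) (auto simp: states_def)
  moreover have "b (adj s v) = 0" if "v \<notin> {1..n}" for v
  proof -
    have "adj s v \<notin> {1..n}" using that adj_in_iff[OF s] by blast
    then show ?thesis using x unfolding states_def by blast
  qed
  ultimately show ?thesis using x by (simp add: states_def fun_eq_iff)
qed

text \<open>As \<open>y\<close> preserves \<open>{s, Suc s}\<close>, it commutes with
  \<open>adj s\<close>. The first alternative of \<open>ys\<close> creates the pair in a step, the
  second one dissolves it for \<open>state_pred_ex\<close>.\<close>

lemma states_swap:
  assumes x: "(b, y) \<in> states n b0" and s: "s \<in> {1..<n}"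
    and bs: "b s = b (Suc s)" and ys: "y s = s \<and> y (Suc s) = Suc s \<or> y s = Suc s \<and> y (Suc s) = s"
  shows "(b, y \<circ> adj s) \<in> states n b0"
proof -
  have y: "y permutes {1..n}" "y (y v) = v" "b (y v) = b v" for v
    using x by (auto simp: states_def fun_eq_iff)
  have "y (adj s (y (adj s v))) = v" for v
  proof (cases "v = s \<or> v = Suc s")
    case False
    then have "y v \<noteq> s" "y v \<noteq> Suc s" using ys y(2) by metis+
    then show ?thesis using False y by simp
  qed (use ys in auto)
  moreover have "b (y (adj s v)) = b v" for v
    using bs by (cases "v = s"; cases "v = Suc s") (simp_all add: y(3))
  moreover have "y \<circ> adj s permutes {1..n}"
    using y s by (intro permutes_compose adj_permutes)
  ultimately show ?thesis using x by (simp add: states_def fun_eq_iff)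
qed

lemma state_step_in:
  assumes x: "x \<in> states n b0" and s: "s \<in> {1..<n}"
  shows "state_step x s \<in> states n b0"
  using assms states_conj[of _ _ n b0 s] states_swap[of _ _ n b0 s]
  by (auto simp: state_step_def split: prod.splits)

text \<open>Within one block, conjugation exchanges \<open>y s\<close> and \<open>y (Suc s)\<close>
  up to an \<open>adj s\<close>, which keeps their order unless they are \<open>s\<close> and
  \<open>Suc s\<close>; in that case the other branch creates the descent.\<close>

lemma descent_state_step: "ascent x s \<Longrightarrow> \<not> ascent (state_step x s) s"
proof -
  assume a: "ascent x s"
  obtain b y where x: "x = (b, y)" by force
  show ?thesis
  proof (cases "b s = b (Suc s) \<and> (y s \<noteq> s \<or> y (Suc s) \<noteq> Suc s)")
    case True
    with a x have "y s < y (Suc s)" by (simp add: ascent_def)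
    moreover from this True have "{y s, y (Suc s)} \<noteq> {s, Suc s}" by (auto simp: doubleton_eq_iff)
    ultimately have "adj s (y s) < adj s (y (Suc s))" by (simp add: adj_less_iff)
    with True a x show ?thesis by (auto simp: state_step_def ascent_def)
  qed (use a x in \<open>auto simp: state_step_def ascent_def\<close>)
qed

lemma state_step_idem: "state_step (state_step x s) s = state_step x s"
  using descent_state_step[of x s] by (cases "ascent x s") (auto simp: state_step_def split: prod.splits)

lemma state_step_fixed_iff: "state_step x s = x \<longleftrightarrow> \<not> ascent x s"
  using descent_state_step[of x s] by (auto simp: state_step_def split: prod.splits)

text \<open>A step is undone by dissolving the pair if \<open>y\<close> pairs \<open>s\<close> with
  \<open>Suc s\<close>, and by conjugating back otherwise.\<close>

lemma state_pred_ex: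
  assumes x: "x \<in> states n b0" and s: "s \<in> {1..<n}" and step: "state_step x s = x"
  shows "\<exists>x' \<in> states n b0. x' \<noteq> x \<and> state_step x' s = x"
proof -
  have na: "\<not> ascent x s" using assms state_step_fixed_iff by blast
  obtain b y where xy: "x = (b, y)" by force
  have y: "y permutes {1..n}" "y (y v) = v" for v
    using x xy by (auto simp: states_def fun_eq_iff)
  have ne: "y s \<noteq> y (Suc s)" using y(2) by (metis n_not_Suc_n)
  obtain x' where x': "x' \<in> states n b0" "ascent x' s" "state_step x' s = x"
  proof (cases "b s = b (Suc s) \<and> y s = Suc s")
    case True
    then have "y (Suc s) = s" using y(2) by metis
    with True have "(b, y \<circ> adj s) \<in> states n b0" "ascent (b, y \<circ> adj s) s"
      "state_step (b, y \<circ> adj s) s = x"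
      using states_swap[of b y n b0 s] x xy s by (auto simp: ascent_def state_step_def comp_assoc)
    then show ?thesis by (rule that)
  next
    case False
    let ?x' = "(b \<circ> adj s, adj s \<circ> y \<circ> adj s)"
    have "?x' \<in> states n b0" using states_conj x xy s by blast
    moreover have "ascent ?x' s \<and> \<not> (b s = b (Suc s) \<and> y s = s \<and> y (Suc s) = Suc s)"
    proof (cases "b s = b (Suc s)")
      case True
      then have lt: "y (Suc s) < y s" using na ne xy by (auto simp: ascent_def)
      moreover have "{y (Suc s), y s} \<noteq> {s, Suc s}" using True False lt by (auto simp: doubleton_eq_iff)
      ultimately show ?thesis using True by (simp add: adj_less_iff ascent_def)
    qed (use na xy in \<open>auto simp: ascent_def\<close>)
    moreover from this have "state_step ?x' s = x"
      by (auto simp: state_step_def xy fun_eq_iff) (metis adj_simps(4) adj_simps(1,2))+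
    ultimately show ?thesis by (intro that) auto
  qed
  then have "x' \<noteq> x" using na by blast
  with x' show ?thesis by blast
qed

text \<open>The ranks determine every \<open>place n x r\<close>. It is \<open>0\<close> at
  \<open>v\<close> exactly if \<open>b v < r\<close>, because \<open>y v\<close> is positive, so
  \<open>b\<close> is recovered; the matrix for \<open>r = b v\<close> then gives
  \<open>y v\<close>.\<close>

lemma state_le_antisym:
  assumes "x \<in> states n b0" "x' \<in> states n b0" "state_le n x x'" "state_le n x' x"
  shows "x = x'"
proof -
  obtain b y b' y' where xy: "x = (b, y)" "x' = (b', y')" by force
  have P: "place n x r v = place n x' r v" if "v \<in> {1..n}" for r v
  proof (rule place_rank_inj[OF is_place_place[OF assms(1)] is_place_place[OF assms(2)] _ that])
    fix i j assume "i \<le> n" "j \<le> n"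
    then show "place_rank n (place n x r) i j = place_rank n (place n x' r) i j"
      using assms(3,4) unfolding state_le_def le_upto_def by (meson le_antisym)
  qed
  have pos: "y v \<noteq> 0" "y' v \<noteq> 0" if "v \<in> {1..n}" for v
    using assms xy that permutes_in_image[of y "{1..n}" v] permutes_in_image[of y' "{1..n}" v]
    by (auto simp: states_def)
  have "b v = b' v \<and> y v = y' v" for v
  proof (cases "v \<in> {1..n}")
    case True
    have "b v < r \<longleftrightarrow> b' v < r" for r
      using P[OF True, of r] pos[OF True] xy by (auto simp: place_def split: if_splits)
    then have b: "b v = b' v" by (metis linorder_neqE_nat nat_less_le)
    with P[OF True, of "b v"] xy show ?thesis by (simp add: place_def)
  next
    case False
    then show ?thesis using assms xy by (auto simp: states_def permutes_def)
  qed
  then show ?thesis using xy by auto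
qed

section \<open>The bottom state\<close>

lemma place_rank_card:
  "place_rank n P i j
    = card {c \<in> {1..n}. j < c \<and> P c = 0} + card {c \<in> {1..n}. c \<le> i \<and> j < P c}"
proof -
  have "{1..n} \<inter> {c. j < c \<and> P c = 0} = {c \<in> {1..n}. j < c \<and> P c = 0}"
    "{1..n} \<inter> {c. c \<le> i \<and> j < P c} = {c \<in> {1..n}. c \<le> i \<and> j < P c}" by auto
  then show ?thesis by (simp only: place_rank_def sum.distrib sum_of_bool_eq finite_atLeastAtMost of_nat_id)
qed

lemma down_closed_eq:
  fixes D :: "nat set"
  assumes "D \<subseteq> {1..n}" "\<And>u v. v \<in> D \<Longrightarrow> 1 \<le> u \<Longrightarrow> u \<le> v \<Longrightarrow> u \<in> D"
  shows "D = {1..card D}"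
proof (cases "D = {}")
  case False
  have fin: "finite D" using assms(1) finite_subset by blast
  have "D = {1..Max D}"
  proof
    show "{1..Max D} \<subseteq> D" using Max_in[OF fin False] assms(2) by auto
  qed (use assms(1) fin in auto)
  then show ?thesis by (metis card_atLeastAtMost diff_Suc_1)
qed simp

text \<open>
  With equality for the bottom state (the next lemma), so that the bottom is the least state.
\<close>

lemma place_rank_lower:
  assumes x: "(b, y) \<in> states n b0" and ij: "i \<le> n" "j \<le> n"
  shows "max (card {v \<in> {1..n}. b v < r} - j) (max (i - card {v \<in> {1..n}. b v < Suc r}) (i - j))
    \<le> place_rank n (place n (b, y) r) i j"
proof -
  let ?P = "place n (b, y) r"
  let ?A = "{c \<in> {1..n}. j < c \<and> ?P c = 0}" and ?B = "{c \<in> {1..n}. c \<le> i \<and> j < ?P c}"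
  have ypos: "y v \<noteq> 0" if "v \<in> {1..n}" for v
    using x that permutes_in_image[of y "{1..n}" v] by (auto simp: states_def)
  have "card {v \<in> {1..n}. b v < r} \<le> card (?A \<union> {1..j})"
    by (rule card_mono) (auto simp: place_def)
  also have "\<dots> \<le> card ?A + j" using card_Un_le[of ?A "{1..j}"] by simp
  finally have 1: "card {v \<in> {1..n}. b v < r} - j \<le> card ?A" by simp
  have "card {1..i} \<le> card (?B \<union> {v \<in> {1..n}. b v < Suc r})"
    by (rule card_mono) (use ij in \<open>auto simp: place_def\<close>)
  also have "\<dots> \<le> card ?B + card {v \<in> {1..n}. b v < Suc r}" by (rule card_Un_le)
  finally have 2: "i - card {v \<in> {1..n}. b v < Suc r} \<le> card ?B" by simp
  \<comment> \<open>\<open>?C\<close> covers what \<open>?A\<close> and \<open>?B\<close> miss of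
    \<open>{1..i}\<close>. It injects into the first \<open>j\<close> columns: \<open>c\<close> goes
    to itself if column \<open>c\<close> has its 1 in row \<open>0\<close>, and otherwise to the
    column of the 1 in row \<open>c\<close>.\<close>
  let ?C = "{c \<in> {1..n}. ?P c \<noteq> 0 \<and> ?P c \<le> j} \<union> {c \<in> {1..j}. ?P c = 0}"
  have inv: "?P (?P c) = c" if "c \<in> {1..n}" "?P c \<in> {1..n}" for c
    using is_place_place[OF x] that unfolding is_place_def by blast
  have "card ?C \<le> card {1..j}"
  proof (rule card_inj_on_le[of "\<lambda>c. if ?P c = 0 then c else ?P c"])
    have "c = d" if "c \<in> ?C" "d \<in> ?C" "?P c \<noteq> 0" "(if ?P d = 0 then d else ?P d) = ?P c" for c d
    proof -
      have C: "e \<in> {1..n}" "?P e \<noteq> 0 \<Longrightarrow> ?P e \<in> {1..n}" if "e \<in> ?C" for e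
        using that ij by (auto simp del: One_nat_def simp: Suc_le_eq)
      have c: "?P (?P c) = c" "c \<noteq> 0" using C[OF that(1)] inv[of c] that(3) by auto
      then have d: "?P d \<noteq> 0" using that by (auto split: if_splits)
      with C[OF that(2)] have dd: "?P (?P d) = d" by (intro inv) auto
      have "?P d = ?P c" using that(4) d by simp
      with c(1) dd show ?thesis by metis
    qed
    then show "inj_on (\<lambda>c. if ?P c = 0 then c else ?P c) ?C"
      unfolding inj_on_def by (metis (no_types, lifting))
  qed auto
  moreover have "card {1..i} \<le> card ((?A \<union> ?B) \<union> ?C)"
    by (rule card_mono) (use ij in auto)
  moreover have "\<dots> \<le> card ?A + card ?B + card ?C"
    by (meson card_Un_le add_right_mono order_trans)
  ultimately have 3: "i - j \<le> card ?A + card ?B" by simp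
  from 1 2 3 show ?thesis by (simp add: place_rank_card)
qed

lemma place_rank_bot:
  assumes mono: "mono_on {1..n} b0" and ij: "i \<le> n" "j \<le> n"
  shows "place_rank n (place n (b0, id) r) i j
    \<le> max (card {v \<in> {1..n}. b0 v < r} - j) (max (i - card {v \<in> {1..n}. b0 v < Suc r}) (i - j))"
proof -
  define m M P where "m = card {v \<in> {1..n}. b0 v < r}"
    and "M = card {v \<in> {1..n}. b0 v < Suc r}" and "P = place n (b0, id) r"
  \<comment> \<open>Since \<open>b0\<close> is monotone, its lower level sets are initial segments.
    Hence \<open>P\<close> is \<open>0\<close> up to \<open>m\<close>, the identity up to
    \<open>M\<close>, and \<open>Suc n\<close> beyond.\<close>
  have D: "{v \<in> {1..n}. b0 v < q} = {1..card {v \<in> {1..n}. b0 v < q}}" for q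
  proof (rule down_closed_eq)
    fix u v assume "v \<in> {v \<in> {1..n}. b0 v < q}" "1 \<le> u" "u \<le> v"
    moreover from this have "b0 u \<le> b0 v" by (intro mono_onD[OF mono]) auto
    ultimately show "u \<in> {v \<in> {1..n}. b0 v < q}" by auto
  qed auto
  have lt: "b0 v < q \<longleftrightarrow> v \<le> card {v \<in> {1..n}. b0 v < q}" if "v \<in> {1..n}" for v q
    using arg_cong[OF D[of q], of "\<lambda>A. v \<in> A"] that by auto
  have mM: "m \<le> M" unfolding m_def M_def by (rule card_mono) auto
  have mn: "m \<le> n" using card_mono[OF finite_atLeastAtMost, of "{v \<in> {1..n}. b0 v < r}" 1 n] unfolding m_def by fastforce
  have Pv: "P v = (if v \<le> m then 0 else if v \<le> M then v else Suc n)" if "v \<in> {1..n}" for v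
    using lt[OF that, of r] lt[OF that, of "Suc r"] unfolding m_def M_def P_def by (auto simp: place_def)
  show ?thesis
    using ij(1) unfolding m_def[symmetric] M_def[symmetric] P_def[symmetric]
  proof (induction i)
    case 0
    have "{c \<in> {1..n}. j < c \<and> P c = 0} = {j<..m}" using mn Pv by (auto split: if_splits)
    moreover have "{c \<in> {1..n}. c \<le> 0 \<and> j < P c} = {}" by auto
    ultimately have "place_rank n P 0 j = m - j"
      by (simp only: place_rank_card card.empty card_greaterThanAtMost add_0_right)
    then show ?case by (simp only: max.cobounded1)
  next
    case (Suc i)
    then show ?case using Pv[of "Suc i"] place_rank_row[of i n P j] mM ij(2)
      by (auto simp: of_bool_def split: if_splits)
  qed
qed

lemma state_le_bot:
  assumes "x \<in> states n b0" "mono_on {1..n} b0"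
  shows "state_le n (b0, id) x"
proof -
  obtain b y where xy: "x = (b, y)" by force
  have C: "card {v \<in> {1..n}. b v < r} = card {v \<in> {1..n}. b0 v < r}" for r
    using assms(1) unfolding xy states_def by blast
  have "place_rank n (place n (b0, id) r) i j \<le> place_rank n (place n x r) i j"
    if ij: "i \<le> n" "j \<le> n" for r i j
  proof -
    note low = place_rank_lower[OF assms(1)[unfolded xy] ij, unfolded C, folded xy]
    show ?thesis by (rule order_trans[OF place_rank_bot[OF assms(2) ij] low])
  qed
  then show ?thesis unfolding state_le_def le_upto_def by blast
qed

text \<open>A step is the monotone \<open>up_op\<close> on every rank matrix. For
  \<open>lifting\<close>, the monotone \<open>down_op\<close> is applied to both sides: it fixes the
  ranks of \<open>x\<close>, which ascends at \<open>s\<close>, and takes those of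
  \<open>state_step y s\<close> back to those of \<open>y\<close>.\<close>

lemma hecke_poset_states:
  assumes mono: "mono_on {1..n} b0" and b0: "\<And>v. v \<notin> {1..n} \<Longrightarrow> b0 v = 0"
  shows "hecke_poset (states n b0) {1..<n} state_step (b0, id) (state_le n)"
proof
  show e: "(b0, id) \<in> states n b0" using b0 by (auto simp: states_def permutes_id)
  show "state_le n (b0, id) x" if "x \<in> states n b0" for x
    using state_le_bot that mono e by blast
  show "state_le n x z" if "state_le n x y" "state_le n y z" for x y z
    using that unfolding state_le_def le_upto_def by (meson le_trans)
  show "state_le n x (state_step x s)" if "x \<in> states n b0" "s \<in> {1..<n}" for x s
    using that by (auto simp: state_le_def le_upto_def place_state_step
        intro!: place_rank_step_ge is_place_place)
  show "state_le n (state_step x s) (state_step y s)"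
    if "x \<in> states n b0" "y \<in> states n b0" "s \<in> {1..<n}" "state_le n x y" for x y s
    unfolding state_le_def le_upto_def
  proof (intro allI impI)
    fix r i j assume ij: "i \<le> n" "j \<le> n"
    have "le_upto n (up_op s (place_rank n (place n x r))) (up_op s (place_rank n (place n y r)))"
      using that(3,4) up_op_mono by (simp add: state_le_def)
    then show "place_rank n (place n (state_step x s) r) i j
      \<le> place_rank n (place n (state_step y s) r) i j"
      using that ij up_op_place[OF is_place_place] by (auto simp: le_upto_def place_state_step)
  qed
  show "state_le n x y"
    if "x \<in> states n b0" "y \<in> states n b0" "s \<in> {1..<n}" "state_step x s \<noteq> x"
      "state_step y s \<noteq> y" "state_le n x (state_step y s)" for x y s
    unfolding state_le_def le_upto_def
  proof (intro allI impI)
    fix r i j assume ij: "i \<le> n" "j \<le> n"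
    have "ascent x s" "ascent y s" using that by (auto simp: state_step_def split: prod.splits if_splits)
    then have asc: "place n x r s \<le> place n x r (Suc s)" "place n y r s \<le> place n y r (Suc s)"
      using that ascent_place_le by blast+
    have "le_upto n (down_op s (place_rank n (place n x r)))
        (down_op s (place_rank n (place n (state_step y s) r)))"
      using that(3,6) down_op_mono by (simp add: state_le_def)
    then show "place_rank n (place n x r) i j \<le> place_rank n (place n y r) i j"
      using that ij asc down_op_place[OF is_place_place] down_op_step[OF is_place_place]
      by (auto simp: le_upto_def place_state_step)
  qed
qed (use state_step_in state_le_antisym state_pred_ex state_step_idem in blast)+

section \<open>Coxeter length\<close>

definition inversions :: "nat \<Rightarrow> (nat \<Rightarrow> nat) \<Rightarrow> (nat \<times> nat) set" where
  "inversions n w = {(i, j). i \<in> {1..n} \<and> j \<in> {1..n} \<and> i < j \<and> w j < w i}"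

abbreviation word_perm :: "nat list \<Rightarrow> nat \<Rightarrow> nat" where
  "word_perm ws \<equiv> foldr (\<circ>) (map adj ws) id"

lemma finite_inversions: "finite (inversions n w)"
  by (rule finite_subset[of _ "{1..n} \<times> {1..n}"]) (auto simp: inversions_def)

text \<open>Moving positions along \<open>adj i\<close> preserves the order of every pair except
  \<open>(i, Suc i)\<close>, which is the only new inversion.\<close>

lemma card_inversions_ascent:
  assumes i: "i \<in> {1..<n}" and w: "w i < w (Suc i)"
  shows "card (inversions n (w \<circ> adj i)) = Suc (card (inversions n w))"
proof -
  let ?f = "map_prod (adj i) (adj i)"
  have *: "(a, b) \<in> inversions n (w \<circ> adj i) \<longleftrightarrow> (a, b) = (i, Suc i) \<or> (adj i a, adj i b) \<in> inversions n w"
    for a b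
  proof (cases "{a, b} = {i, Suc i}")
    case True
    then show ?thesis using i w by (auto simp: inversions_def doubleton_eq_iff)
  next
    case False
    then have "adj i a < adj i b \<longleftrightarrow> a < b" by (rule adj_less_iff)
    moreover have "(a, b) \<noteq> (i, Suc i)" using False by auto
    ultimately show ?thesis using adj_in_iff[OF i] unfolding inversions_def by auto
  qed
  have "inversions n (w \<circ> adj i) = insert (i, Suc i) (?f ` inversions n w)"
  proof (intro set_eqI iffI)
    fix x assume "x \<in> insert (i, Suc i) (?f ` inversions n w)"
    then show "x \<in> inversions n (w \<circ> adj i)" using * by (cases x) auto
  next
    fix x assume x: "x \<in> inversions n (w \<circ> adj i)"
    show "x \<in> insert (i, Suc i) (?f ` inversions n w)"
    proof (cases "x = (i, Suc i)")
      case False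
      with x * have "?f x \<in> inversions n w" by (cases x) auto
      moreover have "?f (?f x) = x" by (cases x) simp
      ultimately show ?thesis by (metis image_eqI insertI2)
    qed simp
  qed
  moreover have "(i, Suc i) \<notin> ?f ` inversions n w"
  proof
    assume "(i, Suc i) \<in> ?f ` inversions n w"
    then obtain a b where ab: "(a, b) \<in> inversions n w" "i = adj i a" "Suc i = adj i b" by auto
    then have "a = adj i i" "b = adj i (Suc i)" by (metis adj_simps(4))+
    with ab(1) show False by (simp add: inversions_def)
  qed
  moreover have "card (?f ` inversions n w) = card (inversions n w)"
    by (rule card_image) (auto simp: inj_on_def)
  ultimately show ?thesis by (simp add: finite_inversions)
qed

lemma card_inversions_descent:
  assumes i: "i \<in> {1..<n}" and w: "w (Suc i) < w i"
  shows "card (inversions n w) = Suc (card (inversions n (w \<circ> adj i)))"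
  using card_inversions_ascent[OF i, of "w \<circ> adj i"] w by (simp add: comp_assoc)

lemma descent_ex:
  assumes w: "w permutes {1..n}" and "w \<noteq> id"
  shows "\<exists>i \<in> {1..<n}. w (Suc i) < w i"
proof (rule ccontr)
  assume *: "\<not> ?thesis"
  have "i \<le> w i" if "i \<in> {1..n}" for i
    using that
  proof (induction i)
    case (Suc i)
    show ?case
    proof (cases "i = 0")
      case True
      then show ?thesis using Suc.prems permutes_in_image[OF w, of "Suc i"] by auto
    next
      case False
      with Suc have "i \<le> w i" "\<not> w (Suc i) < w i" using * by auto
      moreover have "w i \<noteq> w (Suc i)" using inj_eq[OF permutes_inj[OF w]] by simp
      ultimately show ?thesis by simp
    qed
  qed simp
  then have "w = id" using permutes_natset_ge[OF w] by blast
  with \<open>w \<noteq> id\<close> show False ..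
qed

lemma word_perm_snoc: "word_perm (ws @ [i]) = word_perm ws \<circ> adj i"
proof -
  have "foldr (\<circ>) (map adj ws) f = word_perm ws \<circ> f" for f
    by (induction ws) (auto simp: comp_assoc)
  then show ?thesis by simp
qed

lemma word_perm_permutes: "ws \<in> lists {1..<n} \<Longrightarrow> word_perm ws permutes {1..n}"
proof (induction ws)
  case (Cons i ws)
  from Cons.prems have "ws \<in> lists {1..<n}" and i: "i \<in> {1..<n}" by simp_all
  from permutes_compose[OF Cons.IH[OF this(1)] adj_permutes[OF i]]
  have "adj i \<circ> word_perm ws permutes {1..n}" .
  moreover have "word_perm (i # ws) = adj i \<circ> word_perm ws" by simp
  ultimately show ?case by (simp only:)
qed (simp add: permutes_id)

lemma card_inversions_word:
  "ws \<in> lists {1..<n} \<Longrightarrow> card (inversions n (word_perm ws)) \<le> length ws"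
proof (induction ws rule: rev_induct)
  case Nil
  have "inversions n (word_perm []) = {}" by (auto simp: inversions_def)
  then show ?case by (simp only: card.empty list.size)
next
  case (snoc i ws)
  let ?w = "word_perm ws"
  have i: "i \<in> {1..<n}" and ws: "ws \<in> lists {1..<n}" using snoc.prems by auto
  have "?w i \<noteq> ?w (Suc i)" using inj_eq[OF permutes_inj[OF word_perm_permutes[OF ws]]] by simp
  then have "card (inversions n (?w \<circ> adj i)) \<le> Suc (card (inversions n ?w))"
    using card_inversions_ascent[OF i, of ?w] card_inversions_descent[OF i, of ?w]
    by (cases "?w i < ?w (Suc i)") auto
  also have "\<dots> \<le> Suc (length ws)" using snoc.IH[OF ws] by (rule Suc_le_mono[THEN iffD2])
  finally show ?case by (simp only: word_perm_snoc length_append_singleton)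
qed

text \<open>Multiplying by \<open>adj i\<close> at a descent removes exactly one inversion, until
  the identity is reached.\<close>

lemma word_ex:
  "w permutes {1..n} \<Longrightarrow> \<exists>ws \<in> lists {1..<n}. length ws = card (inversions n w) \<and> w = word_perm ws"
proof (induction "card (inversions n w)" arbitrary: w rule: less_induct)
  case less
  show ?case
  proof (cases "w = id")
    case True
    have "inversions n id = {}" by (auto simp: inversions_def)
    then have "card (inversions n w) = 0" using True by (simp only: card.empty)
    with True show ?thesis by (intro bexI[of _ "[]"]) auto
  next
    case False
    then obtain i where i: "i \<in> {1..<n}" "w (Suc i) < w i" using descent_ex less.prems by blast
    have "w \<circ> adj i permutes {1..n}" using less.prems i by (intro permutes_compose adj_permutes)
    from less.hyps[OF _ this] card_inversions_descent[OF i] obtain ws where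
      ws: "ws \<in> lists {1..<n}" "length ws = card (inversions n (w \<circ> adj i))" "w \<circ> adj i = word_perm ws"
      by (metis lessI)
    have "w = word_perm (ws @ [i])"
      unfolding word_perm_snoc ws(3)[symmetric] by (simp add: comp_assoc)
    then show ?thesis using ws i card_inversions_descent[OF i]
      by (intro bexI[of _ "ws @ [i]"]) auto
  qed
qed

lemma cox_length_eq:
  assumes "w permutes {1..n}"
  shows "cox_length n w = card (inversions n w)"
  unfolding cox_length_def
  by (rule Least_equality) (use word_ex[OF assms] card_inversions_word in blast)+

lemma cox_length_right:
  assumes w: "w permutes {1..n}" and i: "i \<in> {1..<n}"
  shows "cox_length n w < cox_length n (w \<circ> adj i) \<longleftrightarrow> w i < w (Suc i)"
proof -
  have "w i \<noteq> w (Suc i)" using inj_eq[OF permutes_inj[OF w]] by simp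
  then show ?thesis
    using card_inversions_ascent[OF i, of w] card_inversions_descent[OF i, of w]
      cox_length_eq[OF w] cox_length_eq[OF permutes_compose[OF adj_permutes[OF i] w]]
    by (cases "w i < w (Suc i)") auto
qed

text \<open>An inversion is a pair of positions whose values are in the opposite order; inverting
  \<open>w\<close> exchanges positions and values.\<close>

lemma cox_length_inv:
  assumes w: "w permutes {1..n}"
  shows "cox_length n (inv w) = cox_length n w"
proof -
  have "bij_betw (\<lambda>(a, b). (inv w b, inv w a)) (inversions n (inv w)) (inversions n w)"
    by (rule bij_betwI[where g = "\<lambda>(a, b). (w b, w a)"])
      (use permutes_in_image[OF w] permutes_in_image[OF permutes_inv[OF w]] permutes_inverses[OF w]
        in \<open>auto simp: inversions_def\<close>)
  then show ?thesis
    using cox_length_eq[OF w] cox_length_eq[OF permutes_inv[OF w]] bij_betw_same_card by metis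
qed

lemma cox_length_left:
  assumes w: "w permutes {1..n}" and i: "i \<in> {1..<n}"
  shows "cox_length n w < cox_length n (adj i \<circ> w) \<longleftrightarrow> inv w i < inv w (Suc i)"
proof -
  have ai: "adj i permutes {1..n}" using adj_permutes[OF i] .
  have "inv (adj i \<circ> w) = inv w \<circ> adj i"
    by (rule inv_unique_comp) (auto simp: fun_eq_iff permutes_inverses[OF w])
  then have "cox_length n (adj i \<circ> w) = cox_length n (inv w \<circ> adj i)"
    using cox_length_inv[OF permutes_compose[OF w ai]] by simp
  then show ?thesis using cox_length_right[OF permutes_inv[OF w] i] cox_length_inv[OF w] by simp
qed

lemma hecke_right_eq:
  "w permutes {1..n} \<Longrightarrow> i \<in> {1..<n} \<Longrightarrow>
    hecke_right n w i = (if w i < w (Suc i) then w \<circ> adj i else w)"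
  by (simp add: hecke_right_def cox_length_right)

lemma hecke_left_eq:
  "w permutes {1..n} \<Longrightarrow> i \<in> {1..<n} \<Longrightarrow>
    hecke_left n i w = (if inv w i < inv w (Suc i) then adj i \<circ> w else w)"
  by (simp add: hecke_left_def cox_length_left)

text \<open>As \<open>w\<close> is its own inverse, left and right ascents agree. At an ascent both
  products are strict, unless \<open>w\<close> fixes \<open>i\<close> and \<open>Suc i\<close>; then
  \<open>adj i\<close> commutes with \<open>w\<close> and the second factor is absorbed.\<close>

lemma hecke_conj_involution:
  assumes w: "w permutes {1..n}" and i: "i \<in> {1..<n}" and inv: "w \<circ> w = id"
  shows "hecke_right n (hecke_left n i w) i =
    (if w i < w (Suc i)
     then if w i = i \<and> w (Suc i) = Suc i then w \<circ> adj i else adj i \<circ> w \<circ> adj i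
     else w)"
proof -
  have invw: "Hilbert_Choice.inv w = w" by (rule inv_unique_comp) (simp_all add: inv)
  have ww: "w (w x) = x" for x using inv by (metis comp_apply id_apply)
  show ?thesis
  proof (cases "w i < w (Suc i)")
    case True
    then have L: "hecke_left n i w = adj i \<circ> w" using hecke_left_eq[OF w i] invw by simp
    have R: "hecke_right n (adj i \<circ> w) i
        = (if adj i (w i) < adj i (w (Suc i)) then adj i \<circ> w \<circ> adj i else adj i \<circ> w)"
      using hecke_right_eq[OF permutes_compose[OF w adj_permutes[OF i]] i] by simp
    show ?thesis
    proof (cases "w i = i \<and> w (Suc i) = Suc i")
      case True
      have "adj i (w x) = w (adj i x)" for x
      proof (cases "x = i \<or> x = Suc i")
        case False
        then have "w x \<noteq> i" "w x \<noteq> Suc i" using True ww by metis+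
        with False show ?thesis by simp
      qed (use True in auto)
      then have "adj i \<circ> w = w \<circ> adj i" by (simp add: fun_eq_iff)
      then show ?thesis using True L R by simp
    next
      case False
      then have "{w i, w (Suc i)} \<noteq> {i, Suc i}" using True by (auto simp: doubleton_eq_iff)
      then have "adj i (w i) < adj i (w (Suc i))" using True by (simp add: adj_less_iff)
      then show ?thesis using True False L R by (simp only: if_True if_False)
    qed
  next
    case False
    then show ?thesis using hecke_left_eq[OF w i] hecke_right_eq[OF w i] invw by simp
  qed
qed

section \<open>Blocks of one-line notation\<close>

text \<open>Together with \<open>elem_rank\<close>, this is the increasing bijection between
  \<open>{1..card V}\<close> and \<open>V\<close>, numbered from 1 like standardizations.\<close>

definition nth_elem :: "nat set \<Rightarrow> nat \<Rightarrow> nat" where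
  "nth_elem V j = sorted_list_of_set V ! (j - 1)"

definition elem_rank :: "nat set \<Rightarrow> nat \<Rightarrow> nat" where
  "elem_rank V v = card {x \<in> V. x \<le> v}"

lemma nth_elem_less_iff:
  assumes "finite V" "a \<in> {1..card V}" "c \<in> {1..card V}"
  shows "nth_elem V a < nth_elem V c \<longleftrightarrow> a < c"
proof -
  have lt: "nth_elem V i < nth_elem V j" if "i < j" "i \<in> {1..card V}" "j \<in> {1..card V}" for i j
    using sorted_wrt_nth_less[OF strict_sorted_list_of_set[of V], of "i - 1" "j - 1"] that
    by (auto simp: nth_elem_def)
  show ?thesis using lt[of a c] lt[of c a] assms by (cases a c rule: linorder_cases) auto
qed

lemma nth_elem_inj: "finite V \<Longrightarrow> inj_on (nth_elem V) {1..card V}"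
  using nth_elem_less_iff by (intro linorder_inj_onI') (auto simp: nat_neq_iff)

lemma nth_elem_in:
  assumes "finite V" "j \<in> {1..card V}"
  shows "nth_elem V j \<in> V"
proof -
  have "j - 1 < length (sorted_list_of_set V)" using assms by auto
  from nth_mem[OF this] show ?thesis using assms(1) by (simp add: nth_elem_def)
qed

lemma nth_elem_image:
  assumes "finite V"
  shows "nth_elem V ` {1..card V} = V"
proof (rule card_subset_eq)
  show "card (nth_elem V ` {1..card V}) = card V"
    using nth_elem_inj[OF assms] by (simp add: card_image)
qed (use assms nth_elem_in in auto)

lemma elem_rank_nth:
  assumes "finite V" "j \<in> {1..card V}"
  shows "elem_rank V (nth_elem V j) = j"
proof -
  have "bij_betw (nth_elem V) {1..j} {x \<in> V. x \<le> nth_elem V j}"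
    unfolding bij_betw_def
  proof
    show "inj_on (nth_elem V) {1..j}" by (rule inj_on_subset[OF nth_elem_inj[OF assms(1)]]) (use assms(2) in auto)
    have "nth_elem V a \<le> nth_elem V j \<longleftrightarrow> a \<le> j" if "a \<in> {1..card V}" for a
      using nth_elem_less_iff[OF assms(1) assms(2) that] by (simp add: not_less[symmetric])
    then have "{x \<in> nth_elem V ` {1..card V}. x \<le> nth_elem V j} = nth_elem V ` {1..j}"
      using assms(2) by auto
    then show "nth_elem V ` {1..j} = {x \<in> V. x \<le> nth_elem V j}"
      using nth_elem_image[OF assms(1)] by simp
  qed
  then show ?thesis unfolding elem_rank_def by (metis bij_betw_same_card card_atLeastAtMost diff_Suc_1)
qed

lemma elem_rank_in:
  assumes "finite V" "v \<in> V"
  shows "elem_rank V v \<in> {1..card V}" "nth_elem V (elem_rank V v) = v"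
proof -
  obtain j where "j \<in> {1..card V}" "v = nth_elem V j" using nth_elem_image[OF assms(1)] assms(2) by blast
  then show "elem_rank V v \<in> {1..card V}" "nth_elem V (elem_rank V v) = v"
    using elem_rank_nth[OF assms(1)] by auto
qed

lemma map_nth_elem:
  assumes "finite V"
  shows "map (\<lambda>j. f (nth_elem V j)) [1..<Suc (card V)] = map f (sorted_list_of_set V)"
  by (rule nth_equalityI) (use assms in \<open>auto simp: nth_elem_def simp del: upt_Suc\<close>)

text \<open>On \<open>{1..card V}\<close>, standardization is \<open>y\<close> transported along the
  increasing bijection: the positions of letters up to a bound correspond under \<open>y\<close> to
  the elements of \<open>V\<close> up to that bound.\<close>

lemma std_map_involution:
  assumes V: "finite V" and y: "\<And>v. v \<in> V \<Longrightarrow> y v \<in> V" "\<And>v. v \<in> V \<Longrightarrow> y (y v) = v"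
    and j: "j \<in> {1..card V}"
  shows "std (map y (sorted_list_of_set V)) j = elem_rank V (y (nth_elem V j))"
proof -
  let ?B = "map y (sorted_list_of_set V)"
  have B: "?B ! (i - 1) = y (nth_elem V i)" if "i \<in> {1..card V}" for i
    using that by (auto simp: nth_elem_def)
  have inj: "i = i'" if "y (nth_elem V i) = y (nth_elem V i')" "i \<in> {1..card V}" "i' \<in> {1..card V}" for i i'
    using that y(2) nth_elem_in[OF V] elem_rank_nth[OF V] by metis
  have "bij_betw (\<lambda>i. y (nth_elem V i)) {i \<in> {1..card V}. y (nth_elem V i) \<le> y (nth_elem V j)}
      {x \<in> V. x \<le> y (nth_elem V j)}"
    by (rule bij_betwI[where g = "\<lambda>x. elem_rank V (y x)"])
      (use nth_elem_in[OF V] elem_rank_nth[OF V] elem_rank_in[OF V] y in \<open>auto simp del: One_nat_def\<close>)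
  moreover have "{i \<in> {1..length ?B}. ?B ! (i - 1) < ?B ! (j - 1) \<or> ?B ! (i - 1) = ?B ! (j - 1) \<and> i \<le> j}
    = {i \<in> {1..card V}. y (nth_elem V i) \<le> y (nth_elem V j)}"
  proof (rule Collect_cong)
    fix i
    show "(i \<in> {1..length ?B} \<and> (?B ! (i - 1) < ?B ! (j - 1) \<or> ?B ! (i - 1) = ?B ! (j - 1) \<and> i \<le> j))
      \<longleftrightarrow> (i \<in> {1..card V} \<and> y (nth_elem V i) \<le> y (nth_elem V j))"
    proof (cases "i \<in> {1..card V}")
      case True
      then show ?thesis using B[OF True] B[OF j] inj[OF _ True j] V by (auto simp del: nth_map)
    qed (use V in auto)
  qed
  ultimately show ?thesis
    unfolding std_def elem_rank_def using j V bij_betw_same_card by auto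
qed

lemma sorted_list_of_set_image:
  assumes "finite V" "\<And>u v. u \<in> V \<Longrightarrow> v \<in> V \<Longrightarrow> u < v \<Longrightarrow> f u < f v"
  shows "sorted_list_of_set (f ` V) = map f (sorted_list_of_set V)"
proof (rule strict_sorted_equal)
  show "sorted_wrt (<) (map f (sorted_list_of_set V))"
    unfolding sorted_wrt_map
    by (rule sorted_wrt_mono_rel[OF _ strict_sorted_list_of_set]) (use assms in auto)
qed (use assms in auto)

section \<open>Positions and their blocks\<close>

lemma length_block [simp]: "length (block \<mu> \<pi> r) = \<mu> ! r"
  by (simp add: block_def)

lemma nth_block: "k < \<mu> ! r \<Longrightarrow> block \<mu> \<pi> r ! k = \<pi> (block_start \<mu> r + Suc k)"
  by (simp add: block_def del: upt_Suc)

lemma set_block: "set (block \<mu> \<pi> r) = \<pi> ` {block_start \<mu> r<..block_start \<mu> r + \<mu> ! r}"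
proof -
  have "{block_start \<mu> r<..block_start \<mu> r + \<mu> ! r} = (+) (block_start \<mu> r) ` {1..<Suc (\<mu> ! r)}"
    unfolding image_add_atLeastLessThan by auto
  then show ?thesis by (simp only: block_def list.set_map set_upt image_image)
qed

lemma block_start_Suc: "r < length \<mu> \<Longrightarrow> block_start \<mu> (Suc r) = block_start \<mu> r + \<mu> ! r"
  by (simp add: block_start_def take_Suc_conv_app_nth)

lemma block_start_mono: "r \<le> r' \<Longrightarrow> block_start \<mu> r \<le> block_start \<mu> r'"
  unfolding block_start_def by (metis le_add1 le_add_diff_inverse sum_list_append take_add)

lemma block_end_le: "r < length \<mu> \<Longrightarrow> block_start \<mu> r + \<mu> ! r \<le> sum_list \<mu>"
  using block_start_mono[of "Suc r" "length \<mu>" \<mu>] block_start_Suc[of r \<mu>] by (simp add: block_start_def)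

lemma block_end_le_start:
  "r < r' \<Longrightarrow> r' < length \<mu> \<Longrightarrow> block_start \<mu> r + \<mu> ! r \<le> block_start \<mu> r'"
  using block_start_mono[of "Suc r" r' \<mu>] block_start_Suc[of r \<mu>] by simp

lemma position_in_block:
  assumes "p \<in> {1..sum_list \<mu>}"
  shows "\<exists>!r. r < length \<mu> \<and> p \<in> {block_start \<mu> r<..block_start \<mu> r + \<mu> ! r}"
proof -
  have "\<exists>r < length \<mu>. p \<in> {block_start \<mu> r<..block_start \<mu> r + \<mu> ! r}"
    if "k \<le> length \<mu>" "p \<in> {1..block_start \<mu> k}" for k
    using that
  proof (induction k)
    case (Suc k)
    show ?case
    proof (cases "p \<le> block_start \<mu> k")
      case False
      with Suc.prems show ?thesis by (intro exI[of _ k]) (auto simp: block_start_Suc)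
    qed (use Suc in auto)
  qed (simp add: block_start_def)
  then obtain r where r: "r < length \<mu>" "p \<in> {block_start \<mu> r<..block_start \<mu> r + \<mu> ! r}"
    using assms by (metis block_start_def order_refl take_all)
  have "r' = r" if "r' < length \<mu>" "p \<in> {block_start \<mu> r'<..block_start \<mu> r' + \<mu> ! r'}" for r'
    using block_end_le_start[of r r' \<mu>] block_end_le_start[of r' r \<mu>] r that
    by (cases r r' rule: linorder_cases) auto
  with r show ?thesis by (intro ex1I[of _ r]) blast+
qed

text \<open>This is the block assignment of the identity; the value \<open>0\<close> outside the
  range meets the normalization in \<open>states\<close>.\<close>

definition pos_block :: "nat list \<Rightarrow> nat \<Rightarrow> nat" where
  "pos_block \<mu> p = (if p \<in> {1..sum_list \<mu>}
     then THE r. r < length \<mu> \<and> p \<in> {block_start \<mu> r<..block_start \<mu> r + \<mu> ! r} else 0)"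

lemma pos_block:
  assumes "p \<in> {1..sum_list \<mu>}"
  shows "pos_block \<mu> p < length \<mu>"
    and "p \<in> {block_start \<mu> (pos_block \<mu> p)<..block_start \<mu> (pos_block \<mu> p) + \<mu> ! pos_block \<mu> p}"
  using theI'[OF position_in_block[OF assms]] assms by (simp_all add: pos_block_def)

lemma pos_block_eqI:
  assumes "r < length \<mu>" "p \<in> {block_start \<mu> r<..block_start \<mu> r + \<mu> ! r}"
  shows "pos_block \<mu> p = r"
proof -
  have p: "p \<in> {1..sum_list \<mu>}" using assms block_end_le[of r \<mu>] by auto
  show ?thesis
    using position_in_block[OF p] pos_block[OF p] assms by blast
qed

lemma mono_on_pos_block: "mono_on {1..sum_list \<mu>} (pos_block \<mu>)"
proof (rule mono_onI)
  fix p q assume pq: "p \<in> {1..sum_list \<mu>}" "q \<in> {1..sum_list \<mu>}" "p \<le> q"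
  show "pos_block \<mu> p \<le> pos_block \<mu> q"
  proof (rule ccontr)
    assume "\<not> ?thesis"
    with pq block_end_le_start[of "pos_block \<mu> q" "pos_block \<mu> p" \<mu>] pos_block[OF pq(1)] pos_block[OF pq(2)]
    show False by auto
  qed
qed

section \<open>States of permutations\<close>

definition value_block :: "nat list \<Rightarrow> (nat \<Rightarrow> nat) \<Rightarrow> nat \<Rightarrow> nat set" where
  "value_block \<mu> b r = {v \<in> {1..sum_list \<mu>}. b v = r}"

text \<open>The \<open>j\<close>th letter of a block is the \<open>y\<close>-partner of the
  \<open>j\<close>th smallest value in it, so \<open>y\<close> is the standardization carried over
  to the values. The relation is proved to be one-to-one below.\<close>

definition rep :: "nat list \<Rightarrow> (nat \<Rightarrow> nat) \<Rightarrow> state \<Rightarrow> bool" where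
  "rep \<mu> \<pi> = (\<lambda>(b, y). (b, y) \<in> states (sum_list \<mu>) (pos_block \<mu>) \<and>
     (\<forall>v \<in> {1..sum_list \<mu>}. b v < length \<mu>) \<and> (\<forall>p. p \<notin> {1..sum_list \<mu>} \<longrightarrow> \<pi> p = p) \<and>
     (\<forall>r < length \<mu>. block \<mu> \<pi> r = map y (sorted_list_of_set (value_block \<mu> b r))))"

lemma finite_value_block [simp]: "finite (value_block \<mu> b r)"
  by (simp add: value_block_def)

lemma state_simps:
  assumes "(b, y) \<in> states n b0"
  shows "y permutes {1..n}" "y (y v) = v" "b (y v) = b v" "y v \<in> {1..n} \<longleftrightarrow> v \<in> {1..n}"
  using assms permutes_in_image[of y "{1..n}" v] unfolding states_def by (auto simp: fun_eq_iff)

lemma rep_state: "rep \<mu> \<pi> (b, y) \<Longrightarrow> (b, y) \<in> states (sum_list \<mu>) (pos_block \<mu>)"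
  by (simp add: rep_def)

lemma rep_set_block:
  assumes "rep \<mu> \<pi> (b, y)" "r < length \<mu>"
  shows "set (block \<mu> \<pi> r) = value_block \<mu> b r"
proof -
  note y = state_simps[OF rep_state[OF assms(1)]]
  have "y ` value_block \<mu> b r = value_block \<mu> b r"
  proof
    show "value_block \<mu> b r \<subseteq> y ` value_block \<mu> b r"
    proof
      fix v assume "v \<in> value_block \<mu> b r"
      then have "y v \<in> value_block \<mu> b r" using y(3,4) by (simp add: value_block_def)
      then show "v \<in> y ` value_block \<mu> b r" using y(2) by (metis image_eqI)
    qed
  qed (use y(3,4) in \<open>auto simp: value_block_def\<close>)
  then show ?thesis using assms by (simp add: rep_def)
qed

lemma rep_block_of:
  assumes "rep \<mu> \<pi> (b, y)" "v \<in> {1..sum_list \<mu>}"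
  shows "block_of \<mu> \<pi> v = b v"
  unfolding block_of_def
proof (rule the_equality)
  have "b v < length \<mu>" using assms by (simp add: rep_def)
  then show "b v < length \<mu> \<and> v \<in> set (block \<mu> \<pi> (b v))"
    using rep_set_block[OF assms(1)] assms(2) by (simp add: value_block_def)
next
  fix r assume "r < length \<mu> \<and> v \<in> set (block \<mu> \<pi> r)"
  then have "v \<in> value_block \<mu> b r" using rep_set_block[OF assms(1)] by blast
  then show "r = b v" by (simp add: value_block_def)
qed

lemma position_cases:
  assumes "p \<in> {1..sum_list \<mu>}"
  obtains r k where "r < length \<mu>" "k < \<mu> ! r" "p = block_start \<mu> r + Suc k"
proof -
  have "p - block_start \<mu> (pos_block \<mu> p) - 1 < \<mu> ! pos_block \<mu> p"
    "p = block_start \<mu> (pos_block \<mu> p) + Suc (p - block_start \<mu> (pos_block \<mu> p) - 1)"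
    using pos_block(2)[OF assms] by auto
  then show ?thesis using that pos_block(1)[OF assms] by blast
qed

lemma rep_left_unique:
  assumes "rep \<mu> \<pi> x" "rep \<mu> \<pi>' x"
  shows "\<pi> = \<pi>'"
proof
  fix p
  obtain b y where x: "x = (b, y)" by force
  show "\<pi> p = \<pi>' p"
  proof (cases "p \<in> {1..sum_list \<mu>}")
    case True
    then obtain r k where r: "r < length \<mu>" "k < \<mu> ! r" "p = block_start \<mu> r + Suc k"
      by (rule position_cases)
    then have "block \<mu> \<pi> r = block \<mu> \<pi>' r" using assms x by (simp add: rep_def)
    then show ?thesis using nth_block[of k \<mu> r] r by metis
  qed (use assms x in \<open>simp add: rep_def\<close>)
qed

lemma rep_right_unique:
  assumes "rep \<mu> \<pi> x" "rep \<mu> \<pi> x'"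
  shows "x = x'"
proof -
  obtain b y b' y' where x: "x = (b, y)" "x' = (b', y')" by force
  note S = rep_state[OF assms(1)[unfolded x]] rep_state[OF assms(2)[unfolded x]]
  have b: "b = b'"
  proof
    fix v
    show "b v = b' v"
    proof (cases "v \<in> {1..sum_list \<mu>}")
      case True
      then show ?thesis using rep_block_of assms x by metis
    next
      case False
      then show ?thesis using S unfolding states_def by auto
    qed
  qed
  have "y v = y' v" for v
  proof (cases "v \<in> {1..sum_list \<mu>}")
    case True
    then have "b v < length \<mu>" using assms x by (simp add: rep_def)
    then have "map y (sorted_list_of_set (value_block \<mu> b (b v)))
        = map y' (sorted_list_of_set (value_block \<mu> b (b v)))"
      using assms x b by (simp add: rep_def)
    moreover have "v \<in> set (sorted_list_of_set (value_block \<mu> b (b v)))"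
      using True by (simp add: value_block_def)
    ultimately show ?thesis by (simp only: map_eq_conv)
  next
    case False
    then show ?thesis using state_simps(1)[OF S(1)] state_simps(1)[OF S(2)] by (metis permutes_not_in)
  qed
  with b x show ?thesis by auto
qed

lemma rep_permutes:
  assumes "rep \<mu> \<pi> x"
  shows "\<pi> permutes {1..sum_list \<mu>}"
proof -
  obtain b y where x: "x = (b, y)" by force
  note rep = assms[unfolded x]
  have "{1..sum_list \<mu>} \<subseteq> \<pi> ` {1..sum_list \<mu>}"
  proof
    fix v assume v: "v \<in> {1..sum_list \<mu>}"
    then have bv: "b v < length \<mu>" using rep by (simp add: rep_def)
    then have "v \<in> set (block \<mu> \<pi> (b v))" using rep_set_block[OF rep] v by (simp add: value_block_def)
    then obtain p where "v = \<pi> p" "p \<in> {block_start \<mu> (b v)<..block_start \<mu> (b v) + \<mu> ! b v}"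
      unfolding set_block by blast
    then show "v \<in> \<pi> ` {1..sum_list \<mu>}" using block_end_le[OF bv] by auto
  qed
  then have "{1..sum_list \<mu>} = \<pi> ` {1..sum_list \<mu>}"
    by (intro card_seteq finite_imageI finite_atLeastAtMost card_image_le)
  then have "bij_betw \<pi> {1..sum_list \<mu>} {1..sum_list \<mu>}"
    unfolding bij_betw_def by (simp add: eq_card_imp_inj_on)
  moreover have "\<pi> p = p" if "p \<notin> {1..sum_list \<mu>}" for p using rep that by (simp add: rep_def)
  ultimately show ?thesis by (rule bij_imp_permutes)
qed

lemma rep_inv:
  assumes "rep \<mu> \<pi> (b, y)" "v \<in> {1..sum_list \<mu>}"
  shows "inv \<pi> v \<in> {block_start \<mu> (b v)<..block_start \<mu> (b v) + \<mu> ! b v}"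
proof -
  have "b v < length \<mu>" using assms by (simp add: rep_def)
  then have "v \<in> set (block \<mu> \<pi> (b v))"
    using rep_set_block[OF assms(1)] assms(2) by (simp add: value_block_def)
  then obtain p where "v = \<pi> p" "p \<in> {block_start \<mu> (b v)<..block_start \<mu> (b v) + \<mu> ! b v}"
    unfolding set_block by blast
  then show ?thesis using permutes_inverses(2)[OF rep_permutes[OF assms(1)]] by simp
qed

text \<open>Blocks occupy successive intervals of positions, so the left ascent condition for values
  of different blocks only compares blocks.\<close>

lemma rep_inv_less_iff:
  assumes rep: "rep \<mu> \<pi> (b, y)" and v: "u \<in> {1..sum_list \<mu>}" "v \<in> {1..sum_list \<mu>}" "b u \<noteq> b v"
  shows "inv \<pi> u < inv \<pi> v \<longleftrightarrow> b u < b v"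
proof -
  have "b u < length \<mu>" "b v < length \<mu>" using rep v by (simp_all add: rep_def)
  then show ?thesis
    using rep_inv[OF rep v(1)] rep_inv[OF rep v(2)] v(3)
      block_end_le_start[of "b u" "b v" \<mu>] block_end_le_start[of "b v" "b u" \<mu>]
    by (cases "b u" "b v" rule: linorder_cases) auto
qed

lemma rep_initial: "rep \<mu> id (pos_block \<mu>, id)"
proof -
  have "block \<mu> id r = sorted_list_of_set (value_block \<mu> (pos_block \<mu>) r)" if r: "r < length \<mu>" for r
  proof (rule strict_sorted_equal)
    show "sorted_wrt (<) (block \<mu> id r)"
      by (auto simp: block_def sorted_wrt_map simp del: upt_Suc intro!: sorted_wrt_mono_rel[OF _ sorted_wrt_upt])
    have "p \<in> {1..sum_list \<mu>}" if "p \<in> {block_start \<mu> r<..block_start \<mu> r + \<mu> ! r}" for p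
      using block_end_le[OF r] that by auto
    then have "{block_start \<mu> r<..block_start \<mu> r + \<mu> ! r} = value_block \<mu> (pos_block \<mu>) r"
      unfolding value_block_def using pos_block_eqI[OF r] pos_block(2) by blast
    then show "set (block \<mu> id r) = set (sorted_list_of_set (value_block \<mu> (pos_block \<mu>) r))"
      by (simp add: set_block)
  qed simp
  moreover have "(pos_block \<mu>, id) \<in> states (sum_list \<mu>) (pos_block \<mu>)"
    by (simp add: states_def permutes_id pos_block_def)
  ultimately show ?thesis by (simp add: rep_def pos_block)
qed

section \<open>The action in terms of states\<close>

lemma rep_swap_values:
  assumes rep: "rep \<mu> \<pi> (b, y)" and i: "i \<in> {1..<sum_list \<mu>}" and ne: "b i \<noteq> b (Suc i)"
  shows "rep \<mu> (adj i \<circ> \<pi>) (b \<circ> adj i, adj i \<circ> y \<circ> adj i)"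
  unfolding rep_def prod.case
proof (intro conjI ballI allI impI)
  show "(b \<circ> adj i, adj i \<circ> y \<circ> adj i) \<in> states (sum_list \<mu>) (pos_block \<mu>)"
    using states_conj[OF rep_state[OF rep] i] .
  show "(b \<circ> adj i) v < length \<mu>" if "v \<in> {1..sum_list \<mu>}" for v
  proof -
    have "adj i v \<in> {1..sum_list \<mu>}" using adj_in_iff[OF i] that by blast
    then show ?thesis using rep by (simp add: rep_def)
  qed
  show "(adj i \<circ> \<pi>) p = p" if "p \<notin> {1..sum_list \<mu>}" for p
  proof -
    have "p \<noteq> i" "p \<noteq> Suc i" using that i by auto
    then show ?thesis using rep that by (simp add: rep_def)
  qed
  fix r assume r: "r < length \<mu>"
  let ?V = "value_block \<mu> b r"
  have "value_block \<mu> (b \<circ> adj i) r = adj i ` ?V"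
  proof (intro set_eqI iffI)
    fix v assume "v \<in> value_block \<mu> (b \<circ> adj i) r"
    then have "adj i v \<in> ?V" using adj_in_iff[OF i, of v] by (simp add: value_block_def)
    then show "v \<in> adj i ` ?V" by (metis adj_simps(4) image_eqI)
  next
    fix v assume "v \<in> adj i ` ?V"
    then obtain u where "u \<in> ?V" "v = adj i u" by blast
    then show "v \<in> value_block \<mu> (b \<circ> adj i) r"
      using adj_in_iff[OF i, of u] by (simp add: value_block_def)
  qed
  \<comment> \<open>No block contains both \<open>i\<close> and \<open>Suc i\<close>, so
    \<open>adj i\<close> is increasing on each value block.\<close>
  moreover have "sorted_list_of_set (adj i ` ?V) = map (adj i) (sorted_list_of_set ?V)"
  proof (rule sorted_list_of_set_image)
    fix u v assume uv: "u \<in> ?V" "v \<in> ?V" "u < v"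
    have "{u, v} \<noteq> {i, Suc i}" using uv ne by (auto simp: value_block_def doubleton_eq_iff)
    then show "adj i u < adj i v" using uv by (simp add: adj_less_iff)
  qed simp
  moreover have "block \<mu> (adj i \<circ> \<pi>) r = map (adj i) (block \<mu> \<pi> r)"
    by (simp add: block_def)
  ultimately show "block \<mu> (adj i \<circ> \<pi>) r
      = map (adj i \<circ> y \<circ> adj i) (sorted_list_of_set (value_block \<mu> (b \<circ> adj i) r))"
    using rep r by (simp add: rep_def)
qed

lemma block_replace_block:
  assumes "length B' = \<mu> ! q" "q < length \<mu>" "r < length \<mu>"
  shows "block \<mu> (replace_block \<mu> \<pi> q B') r = (if r = q then B' else block \<mu> \<pi> r)"
proof (rule nth_equalityI)
  fix k assume "k < length (block \<mu> (replace_block \<mu> \<pi> q B') r)"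
  then have k: "k < \<mu> ! r" by simp
  then have "pos_block \<mu> (block_start \<mu> r + Suc k) = r"
    by (intro pos_block_eqI assms) auto
  then have "block_start \<mu> r + Suc k \<in> {block_start \<mu> q + 1..block_start \<mu> q + \<mu> ! q} \<Longrightarrow> r = q"
    using pos_block_eqI[OF assms(2), of "block_start \<mu> r + Suc k"] by auto
  then show "block \<mu> (replace_block \<mu> \<pi> q B') r ! k = (if r = q then B' else block \<mu> \<pi> r) ! k"
    using k assms(1) by (auto simp: nth_block replace_block_def)
qed (use assms in auto)

lemma involution_permutes: "f \<circ> f = id \<Longrightarrow> (\<And>x. x \<notin> A \<Longrightarrow> f x = x) \<Longrightarrow> f permutes A"
  unfolding permutes_def by (metis comp_apply id_apply)

text \<open>The increasing bijection \<open>nth_elem V\<close> intertwines \<open>std B\<close> with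
  \<open>y\<close> and \<open>adj r\<close> with \<open>adj i\<close>, so the Hecke product on ranks
  becomes the same operation on values.\<close>

lemma restd_conj:
  fixes y :: "nat \<Rightarrow> nat"
  assumes V: "finite V" and y: "\<And>v. v \<in> V \<Longrightarrow> y v \<in> V" "\<And>v. v \<in> V \<Longrightarrow> y (y v) = v"
    and i: "i \<in> V" "Suc i \<in> V"
  defines "B \<equiv> map y (sorted_list_of_set V)" and "k \<equiv> card V"
  defines "r \<equiv> rank_in B i"
  shows "restd B (hecke_right k (hecke_left k r (std B)) r) =
    map (if y i < y (Suc i)
         then if y i = i \<and> y (Suc i) = Suc i then y \<circ> adj i else adj i \<circ> y \<circ> adj i
         else y) (sorted_list_of_set V)"
proof -
  let ?w = "std B" and ?f = "nth_elem V"
  have yV: "y ` V = V" using y by (metis image_eqI subsetI subset_antisym image_subsetI)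
  have setB: "set B = V" using V yV by (simp add: B_def)
  have lenB: "length B = k" by (simp add: B_def k_def)
  have "inj_on y V" using y by (metis inj_onI)
  then have "distinct B" using V by (simp add: B_def distinct_map)
  then have sortB: "sort B = sorted_list_of_set V"
    using sorted_list_of_set_sort_remdups[of B] setB by (simp add: distinct_remdups_id)
  have r: "r = elem_rank V i" by (simp add: r_def rank_in_def setB elem_rank_def)
  \<comment> \<open>Consecutive values of the same block have consecutive ranks.\<close>
  have "{x \<in> V. x \<le> Suc i} = insert (Suc i) {x \<in> V. x \<le> i}" using i by (auto simp: le_Suc_eq)
  then have "elem_rank V (Suc i) = Suc r" using V by (simp add: elem_rank_def r)
  then have rk: "r \<in> {1..<k}" and fr: "?f r = i" "?f (Suc r) = Suc i"
    using elem_rank_in[OF V i(1)] elem_rank_in[OF V i(2)] by (auto simp: r k_def)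
  have rk': "r \<in> {1..k}" "Suc r \<in> {1..k}" using rk by auto
  have w: "?w j = elem_rank V (y (?f j))" if "j \<in> {1..k}" for j
    using std_map_involution[OF V y] that unfolding B_def k_def by blast
  have w_in: "?w j \<in> {1..k}" and fw: "?f (?w j) = y (?f j)" if j: "j \<in> {1..k}" for j
  proof -
    have "y (?f j) \<in> V" using nth_elem_in[OF V] j y(1) unfolding k_def by blast
    then show "?w j \<in> {1..k}" "?f (?w j) = y (?f j)"
      using elem_rank_in[OF V, of "y (?f j)"] w[OF j] by (simp_all add: k_def)
  qed
  have w_out: "?w j = j" if "j \<notin> {1..k}" for j using that lenB by (auto simp: std_def)
  have f_inj: "?f a = ?f c \<longleftrightarrow> a = c" if "a \<in> {1..k}" "c \<in> {1..k}" for a c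
    using inj_on_eq_iff[OF nth_elem_inj[OF V]] that by (simp add: k_def)
  have f_less: "?f a < ?f c \<longleftrightarrow> a < c" if "a \<in> {1..k}" "c \<in> {1..k}" for a c
    using nth_elem_less_iff[OF V] that by (simp add: k_def)
  have "?w (?w j) = j" for j
  proof (cases "j \<in> {1..k}")
    case True
    have "?f j \<in> V" using nth_elem_in[OF V] True by (simp add: k_def)
    then have "?f (?w (?w j)) = ?f j" using fw[OF w_in[OF True]] fw[OF True] y(2) by simp
    then show ?thesis using f_inj w_in True by blast
  qed (simp add: w_out)
  then have ww: "?w \<circ> ?w = id" by (simp add: fun_eq_iff)
  have perm: "?w permutes {1..k}" by (rule involution_permutes[OF ww w_out])
  have cond: "?w r < ?w (Suc r) \<longleftrightarrow> y i < y (Suc i)"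
    "?w r = r \<longleftrightarrow> y i = i" "?w (Suc r) = Suc r \<longleftrightarrow> y (Suc i) = Suc i"
    using f_less[OF w_in[OF rk'(1)] w_in[OF rk'(2)]] f_inj[OF w_in[OF rk'(1)] rk'(1)]
      f_inj[OF w_in[OF rk'(2)] rk'(2)] fw[OF rk'(1)] fw[OF rk'(2)] fr by simp_all
  have adj_in: "adj r j \<in> {1..k}" if "j \<in> {1..k}" for j
    using adj_in_iff[OF rk] that by blast
  have f_adj: "?f (adj r j) = adj i (?f j)" if j: "j \<in> {1..k}" for j
  proof -
    consider "j = r" | "j = Suc r" | "j \<noteq> r" "j \<noteq> Suc r" by blast
    then show ?thesis
    proof cases
      case 3
      then have "?f j \<noteq> i" "?f j \<noteq> Suc i" using f_inj[OF j rk'(1)] f_inj[OF j rk'(2)] fr by simp_all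
      with 3 show ?thesis by simp
    qed (simp_all add: fr)
  qed
  define u y' where "u = (if ?w r < ?w (Suc r)
      then if ?w r = r \<and> ?w (Suc r) = Suc r then ?w \<circ> adj r else adj r \<circ> ?w \<circ> adj r else ?w)"
    and "y' = (if y i < y (Suc i)
      then if y i = i \<and> y (Suc i) = Suc i then y \<circ> adj i else adj i \<circ> y \<circ> adj i else y)"
  have fu: "?f (u j) = y' (?f j)" if j: "j \<in> {1..k}" for j
  proof -
    have "?f (?w (adj r j)) = y (adj i (?f j))" using fw[OF adj_in[OF j]] f_adj[OF j] by simp
    moreover have "?f (adj r (?w (adj r j))) = adj i (?f (?w (adj r j)))"
      using f_adj[OF w_in[OF adj_in[OF j]]] .
    ultimately show ?thesis using fw[OF j] unfolding u_def y'_def cond by simp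
  qed
  have "hecke_right k (hecke_left k r ?w) r = u"
    unfolding u_def by (rule hecke_conj_involution[OF perm rk ww])
  moreover have "restd B u = map (\<lambda>j. ?f (u j)) [1..<Suc k]"
    by (simp only: restd_def sortB nth_elem_def lenB)
  moreover have "\<dots> = map (\<lambda>j. y' (?f j)) [1..<Suc k]"
    by (rule map_cong[OF refl]) (use fu in \<open>simp del: upt_Suc\<close>)
  moreover have "\<dots> = map y' (sorted_list_of_set V)"
    unfolding k_def by (rule map_nth_elem[OF V])
  ultimately have "restd B (hecke_right k (hecke_left k r ?w) r) = map y' (sorted_list_of_set V)"
    by (simp only:)
  then show ?thesis by (simp only: y'_def)
qed

lemma rep_mu_act:
  assumes rep: "rep \<mu> \<pi> x" and i: "i \<in> {1..<sum_list \<mu>}"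
  shows "rep \<mu> (mu_act \<mu> \<pi> i) (state_step x i)"
proof -
  obtain b y where x: "x = (b, y)" by force
  note rep = rep[unfolded x]
  note y = state_simps[OF rep_state[OF rep]]
  have iv: "i \<in> {1..sum_list \<mu>}" "Suc i \<in> {1..sum_list \<mu>}" using i by auto
  note blk = rep_block_of[OF rep iv(1)] rep_block_of[OF rep iv(2)]
  show ?thesis
  proof (cases "b i = b (Suc i)")
    case False
    have "mu_act \<mu> \<pi> i = (if b i < b (Suc i) then adj i \<circ> \<pi> else \<pi>)"
      using False blk hecke_left_eq[OF rep_permutes[OF rep] i] rep_inv_less_iff[OF rep iv False]
      by (simp add: mu_act_def)
    moreover have "state_step x i =
        (if b i < b (Suc i) then (b \<circ> adj i, adj i \<circ> y \<circ> adj i) else (b, y))"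
      using False by (simp add: state_step_def ascent_def x)
    ultimately show ?thesis using rep rep_swap_values[OF rep i False] by simp
  next
    case True
    define q where "q = b i"
    have q: "q < length \<mu>" using rep iv by (simp add: rep_def q_def)
    let ?V = "value_block \<mu> b q"
    define y' where "y' = (if y i < y (Suc i)
      then if y i = i \<and> y (Suc i) = Suc i then y \<circ> adj i else adj i \<circ> y \<circ> adj i else y)"
    have B: "block \<mu> \<pi> q = map y (sorted_list_of_set ?V)" using rep q by (simp add: rep_def)
    have len: "\<mu> ! q = card ?V" using arg_cong[OF B, of length] by simp
    have V: "i \<in> ?V" "Suc i \<in> ?V" using iv True by (auto simp: value_block_def q_def)
    have yV: "y v \<in> value_block \<mu> b r \<longleftrightarrow> v \<in> value_block \<mu> b r" for v r
      by (simp only: value_block_def mem_Collect_eq y(3,4))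
    have bq: "block_of \<mu> \<pi> i = q" "block_of \<mu> \<pi> (Suc i) = q" using blk True by (simp_all add: q_def)
    have "restd (block \<mu> \<pi> q) (hecke_right (card ?V) (hecke_left (card ?V)
        (rank_in (block \<mu> \<pi> q) i) (std (block \<mu> \<pi> q))) (rank_in (block \<mu> \<pi> q) i))
      = map y' (sorted_list_of_set ?V)"
      unfolding B y'_def by (rule restd_conj[OF finite_value_block _ y(2) V]) (simp only: yV)
    then have act: "mu_act \<mu> \<pi> i = replace_block \<mu> \<pi> q (map y' (sorted_list_of_set ?V))"
      by (simp only: mu_act_def Let_def bq length_block len if_False simp_thms)
    \<comment> \<open>Inside one block, the conjugation in \<open>state_step\<close> leaves the
      block assignment unchanged.\<close>
    have "b \<circ> adj i = b"
    proof
      fix v show "(b \<circ> adj i) v = b v" using True by (cases "v = i"; cases "v = Suc i") auto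
    qed
    then have step: "state_step x i = (b, y')"
      using True by (simp add: state_step_def ascent_def x y'_def)
    have y'_other: "y' v = y v" if "v \<in> value_block \<mu> b r" "r \<noteq> q" for v r
    proof -
      have "v \<noteq> i" "v \<noteq> Suc i" "y v \<noteq> i" "y v \<noteq> Suc i"
        using that V yV[of v r] by (auto simp: value_block_def)
      then show ?thesis by (simp add: y'_def)
    qed
    have "block \<mu> (mu_act \<mu> \<pi> i) r = map y' (sorted_list_of_set (value_block \<mu> b r))"
      if r: "r < length \<mu>" for r
    proof (cases "r = q")
      case True
      then show ?thesis using len q by (simp add: act block_replace_block)
    next
      case False
      have "block \<mu> \<pi> r = map y (sorted_list_of_set (value_block \<mu> b r))"
        using rep r by (simp add: rep_def)
      also have "\<dots> = map y' (sorted_list_of_set (value_block \<mu> b r))"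
        using y'_other[OF _ False] by simp
      finally show ?thesis using False len q r by (simp add: act block_replace_block)
    qed
    moreover have "mu_act \<mu> \<pi> i p = p" if "p \<notin> {1..sum_list \<mu>}" for p
    proof -
      have "p \<notin> {block_start \<mu> q + 1..block_start \<mu> q + \<mu> ! q}"
        using that block_end_le[OF q] by auto
      moreover have "\<pi> p = p" using rep that by (simp add: rep_def)
      ultimately show ?thesis unfolding act replace_block_def by (simp only: if_False)
    qed
    moreover have "(b, y') \<in> states (sum_list \<mu>) (pos_block \<mu>)"
      using state_step_in[OF rep_state[OF rep] i] step x by simp
    moreover have "\<forall>v \<in> {1..sum_list \<mu>}. b v < length \<mu>" using rep by (simp add: rep_def)
    ultimately show ?thesis unfolding rep_def step prod.case by blast
  qed
qed

lemma rep_mu_eval: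
  assumes "a \<in> lists {1..<sum_list \<mu>}"
  shows "rep \<mu> (mu_eval \<mu> a) (foldl state_step (pos_block \<mu>, id) a)"
  using assms
proof (induction a rule: rev_induct)
  case Nil
  show ?case by (simp only: mu_eval_def foldl.simps rep_initial)
next
  case (snoc i a)
  then show ?case using rep_mu_act by (simp add: mu_eval_def)
qed

theorem theorem3p16:
  fixes n m :: nat and \<mu> a :: "nat list" and \<tau> :: "nat \<Rightarrow> nat"
  assumes "is_composition n \<mu>"
    and "\<tau> \<in> mu_involutions \<mu>"
    and "nearly_mu_reduced \<mu> a m \<tau>"
  shows "\<exists>!k. k \<noteq> m \<and> nearly_mu_reduced \<mu> a k \<tau>"
proof -
  let ?A = "{1..<sum_list \<mu>}" and ?e = "(pos_block \<mu>, id)"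
  interpret hecke_poset "states (sum_list \<mu>) (pos_block \<mu>)" ?A state_step ?e "state_le (sum_list \<mu>)"
    by (rule hecke_poset_states[OF mono_on_pos_block]) (simp only: pos_block_def if_False)
  \<comment> \<open>\<open>rep\<close> is one-to-one, so equality of elements is equality of states,
    and reducedness carries over because it only compares words with equal values.\<close>
  have eval_iff: "mu_eval \<mu> v = mu_eval \<mu> w \<longleftrightarrow> run ?e v = run ?e w"
    if "v \<in> lists ?A" "w \<in> lists ?A" for v w
    using rep_mu_eval[OF that(1)] rep_mu_eval[OF that(2)] rep_left_unique rep_right_unique by metis
  have red_iff: "mu_reduced \<mu> w \<longleftrightarrow> reduced w" if "w \<in> lists ?A" for w
    using eval_iff[OF _ that] that unfolding mu_reduced_def mu_words_def
    by (auto simp: not_less[symmetric] simp del: in_lists_conv_set)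
  have a: "a \<in> lists ?A" using assms(3) by (simp add: nearly_mu_reduced_def)
  have del: "delete_at k a \<in> lists ?A" for k
    using a by (auto simp: delete_at_def dest: in_set_takeD in_set_dropD)
  \<comment> \<open>The state that represents \<tau>.\<close>
  define \<sigma> where "\<sigma> = run ?e (delete_at m a)"
  have m: "m \<in> {1..length a}" "\<not> mu_reduced \<mu> a" "mu_reduced \<mu> (delete_at m a)"
    "mu_eval \<mu> (delete_at m a) = \<tau>"
    using assms(3) by (auto simp: nearly_mu_reduced_def mu_reduced_words_def mu_words_def)
  have "nearly_mu_reduced \<mu> a k \<tau> \<longleftrightarrow>
      k \<in> {1..length a} \<and> reduced (delete_at k a) \<and> run ?e (delete_at k a) = \<sigma>" for k
    using a m red_iff[OF del] eval_iff[OF del del, of k m] del[of k]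
    unfolding nearly_mu_reduced_def mu_reduced_words_def mu_words_def \<sigma>_def by auto
  moreover have "\<exists>!k. k \<noteq> m \<and> k \<in> {1..length a} \<and> reduced (delete_at k a) \<and> run ?e (delete_at k a) = \<sigma>"
    by (rule nearly_reduced_unique) (use a m red_iff[OF a] red_iff[OF del] \<sigma>_def in blast)+
  ultimately show ?thesis by (simp only:)
qed

end
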